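(* Let $d\ge 2$, let $Q_1$ and $Q_2$ be $d$-variate quasi-copulas and let $\varepsilon>0$. Then there exist $d$-variate quasi-copulas $A_1$ and $A_2$ such that $\|Q_1-A_1\|_\infty<\varepsilon$, $\|Q_2-A_2\|_\infty<\varepsilon$, and $A_1$ is a shuffle of $A_2$.
   Context: $\|\cdot\|_\infty$ is the supremum norm on $[0,1]^d$. A $d$-variate quasi-copula is a function $A\colon[0,1]^d\to[0,1]$ such that (i) $A(1,\ldots,1,u_j,1,\ldots,1)=u_j$ for every $j\in\{1,\dots,d\}$ and $u_j\in[0,1]$; (ii) $A$ is increasing (non-decreasing) in each variable; (iii) $|A(\mathbf{v})-A(\mathbf{u})|\le\sum_{j=1}^d|v_j-u_j|$ for all $\mathbf{u},\mathbf{v}\in[0,1]^d$. For a box $R=(x_1,y_1]\times\cdots\times(x_d,y_d]\subseteq[0,1]^d$ put $V_A(R)=\sum_{\mathbf{v}}\operatorname{sign}_R(\mathbf{v})A(\mathbf{v})$, the sum being over $\mathbf{v}\in\{x_1,y_1\}\times\cdots\times\{x_d,y_d\}$, with $\operatorname{sign}_R(\mathbf v)=1$ if $v_j=x_j$ for an even number of indices $j$ and $-1$ otherwise. A quasi-copula $Q$ induces a unique finitely-additive signed measure $\mu_Q$ on the algebra of finite disjoint unions of half-open boxes in $[0,1]^d$ with $\mu_Q(R)=V_Q(R)$ for all half-open boxes $R$. Shuffle: for each $k\in\{1,\dots,d\}$ let $J_i^k=(a_{i-1}^k,a_i^k]$, $i=1,\dots,n_k$, be a partition of $(0,1]$ with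 $0=a_0^k\le a_1^k\le\cdots\le a_{n_k}^k=1$, let $\pi_k$ be a permutation of $\{1,\dots,n_k\}$, and let $\phi_k\colon[0,1]\to[0,1]$ be given by $\phi_k(0)=0$ and $\phi_k(t)=t-a_{i-1}^k+\sum_{j:\,\pi_k(j)<\pi_k(i)}\lambda(J_j^k)$ for $t\in J_i^k$, where $\lambda$ is Lebesgue measure. Put $\phi(t_1,\dots,t_d)=(\phi_1(t_1),\dots,\phi_d(t_d))$. The function $(x_1,\dots,x_d)\mapsto\mu_Q\big(\phi^{-1}((0,x_1]\times\cdots\times(0,x_d])\big)$ on $[0,1]^d$ is called a shuffle of $Q$ (any choice of partitions and permutations is allowed; a shuffle of a quasi-copula need not be a quasi-copula). *)

theory Defs
  imports "HOL-Analysis.Analysis" "HOL-Combinatorics.Permutations"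
begin

text \<open>
  The dimension is \<open>CARD('n)\<close>, and the unit cube is \<open>cbox 0 1\<close> (vectors \<open>0\<close> and \<open>1\<close> being constant).
  A function on the cube is represented by a function on \<open>real ^ 'n\<close> of which only the values on
  the cube are used.
\<close>

definition quasi_copula :: "(real ^ 'n \<Rightarrow> real) \<Rightarrow> bool" where
  "quasi_copula A \<longleftrightarrow>
     (\<forall>u \<in> cbox 0 1. A u \<in> {0..1}) \<and>
     (\<forall>j. \<forall>t \<in> {0..1}. A (\<chi> i. if i = j then t else 1) = t) \<and>
     (\<forall>u \<in> cbox 0 1. \<forall>j. \<forall>t \<in> {0..1}.
        u $ j \<le> t \<longrightarrow> A u \<le> A (\<chi> i. if i = j then t else u $ i)) \<and>
     (\<forall>u \<in> cbox 0 1. \<forall>v \<in> cbox 0 1. \<bar>A v - A u\<bar> \<le> (\<Sum>j\<in>UNIV. \<bar>v $ j - u $ j\<bar>))"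

definition sup_norm :: "(real ^ 'n \<Rightarrow> real) \<Rightarrow> real" where
  "sup_norm f = (SUP u \<in> cbox 0 1. \<bar>f u\<bar>)"

definition half_open_box :: "real ^ 'n \<Rightarrow> real ^ 'n \<Rightarrow> (real ^ 'n) set" where
  "half_open_box x y = {t. \<forall>j. x $ j < t $ j \<and> t $ j \<le> y $ j}"

text \<open>
  Boxes are nondegenerate: if \<open>x $ j = y $ j\<close> for some \<open>j\<close>, the set of vertices of the box collapses
  and the signed sum \<open>box_volume\<close> over it would not be zero.  The empty set belongs to
  \<open>box_algebra\<close> as the empty union.
\<close>

definition cube_corners :: "real ^ 'n \<Rightarrow> real ^ 'n \<Rightarrow> bool" where
  "cube_corners x y \<longleftrightarrow> x \<in> cbox 0 1 \<and> y \<in> cbox 0 1 \<and> (\<forall>j. x $ j < y $ j)"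

definition box_volume :: "(real ^ 'n \<Rightarrow> real) \<Rightarrow> real ^ 'n \<Rightarrow> real ^ 'n \<Rightarrow> real" where
  "box_volume A x y =
     (\<Sum>v | \<forall>j. v $ j \<in> {x $ j, y $ j}.
        (if even (card {j. v $ j = x $ j}) then 1 else - 1) * A v)"

definition box_algebra :: "(real ^ 'n) set set" where
  "box_algebra =
     {\<Union>\<R> | \<R>. finite \<R> \<and> disjoint \<R> \<and> \<R> \<subseteq> {half_open_box x y | x y. cube_corners x y}}"

text \<open>
  The finitely additive signed measure induced by \<open>Q\<close>: the description is by unique existence
  on \<open>box_algebra\<close>, and \<open>extensional\<close> only fixes the values elsewhere.
\<close>

definition induced_measure :: "(real ^ 'n \<Rightarrow> real) \<Rightarrow> (real ^ 'n) set \<Rightarrow> real" where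
  "induced_measure Q =
     (THE \<mu>. \<mu> \<in> extensional box_algebra \<and>
             Measure_Space.additive box_algebra \<mu> \<and>
             (\<forall>x y. cube_corners x y \<longrightarrow> \<mu> (half_open_box x y) = box_volume Q x y))"

definition unit_partition :: "nat \<Rightarrow> (nat \<Rightarrow> real) \<Rightarrow> bool" where
  "unit_partition n a \<longleftrightarrow> a 0 = 0 \<and> a n = 1 \<and> (\<forall>i \<in> {1..n}. a (i - 1) \<le> a i)"

definition shuffle_map :: "nat \<Rightarrow> (nat \<Rightarrow> real) \<Rightarrow> (nat \<Rightarrow> nat) \<Rightarrow> real \<Rightarrow> real" where
  "shuffle_map n a p t =
     (if t = 0 then 0
      else let i = (THE i. i \<in> {1..n} \<and> t \<in> {a (i - 1)<..a i})
           in t - a (i - 1) + (\<Sum>j | j \<in> {1..n} \<and> p j < p i. measure lborel {a (j - 1)<..a j}))"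

definition is_shuffle_of :: "(real ^ 'n \<Rightarrow> real) \<Rightarrow> (real ^ 'n \<Rightarrow> real) \<Rightarrow> bool" where
  "is_shuffle_of A Q \<longleftrightarrow>
     (\<exists>(n :: 'n \<Rightarrow> nat) (a :: 'n \<Rightarrow> nat \<Rightarrow> real) (p :: 'n \<Rightarrow> nat \<Rightarrow> nat).
        (\<forall>k. unit_partition (n k) (a k) \<and> p k permutes {1..n k}) \<and>
        (\<forall>x \<in> cbox 0 1.
           A x = induced_measure Q
                   {t \<in> cbox 0 1. (\<chi> k. shuffle_map (n k) (a k) (p k) (t $ k)) \<in> half_open_box 0 x}))"

end

theory Submission
  imports Defs
begin

text \<open>
  \<^bold>\<open>Exchanging two levels of a grid.\<close>  Cut \<open>[0, 1]\<close> into \<open>m\<close> intervals of equal length and each of these into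
  \<open>m\<close> again, so that the fine interval with index \<open>i * m + j\<close> is the \<open>j\<close>-th part of the \<open>i\<close>-th
  coarse interval.  On every axis the shuffle moves the fine interval \<open>i * m + j\<close> to the
  place \<open>j * m + i\<close>.  A signed measure that has mass \<open>\<nu>(i, j)\<close>, uniformly distributed, on the
  fine cell with multi-indices \<open>i\<close> and \<open>j\<close> is described, up to errors of the size of a coarse cell,
  by the marginal \<open>i \<mapsto> \<Sum>j. \<nu>(i, j)\<close>, and its shuffle is described by the other marginal
  \<open>j \<mapsto> \<Sum>i. \<nu>(i, j)\<close>.  Hence it suffices to find an array \<open>\<nu>\<close> whose two marginals are nearly the
  coarse cell masses \<open>q2\<close> and \<open>q1\<close> of \<open>Q2\<close> and \<open>Q1\<close>, and which gives a quasi-copula both before and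
  after the exchange.

  \<^bold>\<open>The array.\<close>  The product \<open>q2(i) q1(j)\<close> has the right marginals, but the masses are signed, and from
  dimension three on monotone functions are not to be expected from it.  Instead, with \<open>u\<close> the uniform masses,
  take \<open>\<nu>(i, j) = u(i) u(j) + \<theta> ((q2 - u)(i) w(j) + w(i) (q1 - u)(j))\<close>, with the marginals
  \<open>u + \<theta> (q2 - u)\<close> and \<open>u + \<theta> (q1 - u)\<close>.  Here \<open>\<theta>\<close> is slightly smaller than 1 and \<open>w\<close> distributes mass 1 uniformly over a core of cells that
  stays at distance \<open>\<delta>\<close> or more from all faces of the cube.  This expression is symmetric under the exchange of \<open>i\<close> with
  \<open>j\<close> and of \<open>q2\<close> with \<open>q1\<close>, so both quasi-copulas are given by one construction, \<open>blend\<close>,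
  with the roles of \<open>Q1\<close> and \<open>Q2\<close> interchanged (lemma \<open>blend_is_shuffle\<close>).

  \<^bold>\<open>Why it is a quasi-copula.\<close>  An increment of \<open>blend\<close> in one coordinate, from \<open>s\<close> to \<open>t\<close>, must lie
  between \<open>0\<close> and \<open>t - s\<close>.  Let \<open>V\<close> be the product of the other coordinates.  The part of \<open>\<nu>\<close>
  without \<open>w(i) (q1 - u)(j)\<close> gives an interpolation of \<open>Q2\<close>, slightly mixed with the product copula; thanks to \<open>\<theta> < 1\<close> its
  increments stay above \<open>0\<close> by \<open>\<eta> V (t - s)\<close> and below \<open>t - s\<close> by \<open>\<eta> (1 - V) (t - s)\<close>.  The part
  \<open>w(i) (q1 - u)(j)\<close> consists of many small copies of the difference between \<open>Q1\<close> and the product copula.  A copy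
  contributes to an increment only if its coarse cell meets the point in one of the other
  coordinates, since that difference vanishes when all other arguments are 1 or one of them is 0.  So its
  contribution is of order \<open>1 / m\<close>, and by the choice of the core it vanishes altogether
  where \<open>V\<close> or \<open>1 - V\<close> is too small to absorb it (lemma \<open>blend_incr\<close>).  For large \<open>m\<close> both bounds
  follow, and all error terms are small (lemma \<open>blend_close\<close>).
\<close>

section \<open>Finitely additive measures on the box algebra\<close>

lemma half_open_box_measurable: "half_open_box a b \<in> sets borel"
proof -
  have "half_open_box a b = (\<Inter>j. {t. a $ j < t $ j} \<inter> {t. t $ j \<le> b $ j})"
    by (auto simp: half_open_box_def)
  moreover have "{t. a $ j < t $ j} \<inter> {t. t $ j \<le> b $ j} \<in> sets borel" for j
    using open_halfspace_component_gt_cart[of "a $ j" j]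
      closed_halfspace_component_le_cart[of j "b $ j"] by auto
  ultimately show ?thesis
    by (simp add: sets.finite_INT)
qed

lemma half_open_box_fmeasurable: "half_open_box a b \<in> fmeasurable lborel"
proof -
  have "half_open_box a b \<subseteq> cbox a b"
    by (auto simp: half_open_box_def mem_box_cart less_imp_le)
  then show ?thesis
    using emeasure_mono[of "half_open_box a b" "cbox a b" lborel] emeasure_lborel_cbox_finite[of a b]
      half_open_box_measurable by (auto simp: fmeasurable_def)
qed

lemma measure_half_open_box:
  "measure lborel (half_open_box a b) = (\<Prod>k\<in>UNIV. max 0 (b $ k - a $ k))"
proof (cases "\<forall>k. a $ k \<le> b $ k")
  case True
  have sub: "box a b \<subseteq> half_open_box a b" "half_open_box a b \<subseteq> cbox a b"
    by (auto simp: half_open_box_def mem_box_cart less_imp_le)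
  have "measure lborel (half_open_box a b) \<le> measure lborel (cbox a b)"
    using sub(2) half_open_box_measurable by (intro measure_mono_fmeasurable) auto
  moreover have "measure lborel (box a b) \<le> measure lborel (half_open_box a b)"
    by (rule measure_mono_fmeasurable[OF sub(1) _ half_open_box_fmeasurable]) simp
  moreover have "measure lborel (box a b) = measure lborel (cbox a b)"
    by (simp add: measure_lborel_box_eq measure_lborel_cbox_eq)
  moreover have "measure lborel (cbox a b) = (\<Prod>k\<in>UNIV. b $ k - a $ k)"
    using True by (subst content_cbox_cart) (auto simp: interval_ne_empty_cart)
  ultimately show ?thesis
    using True by simp
next
  case False
  then obtain k where k: "b $ k < a $ k" by (auto simp: not_le)
  then have "half_open_box a b = {}"
    by (auto simp: half_open_box_def intro!: exI[of _ k])
  moreover have "(\<Prod>k\<in>UNIV. max 0 (b $ k - a $ k)) = 0"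
    using k by (intro prod_zero) (auto intro!: exI[of _ k])
  ultimately show ?thesis by simp
qed

lemma half_open_box_Int:
  "half_open_box a b \<inter> half_open_box a' b' =
   half_open_box (\<chi> k. max (a $ k) (a' $ k)) (\<chi> k. min (b $ k) (b' $ k))"
  by (auto simp: half_open_box_def)

lemma box_algebra_Union:
  assumes "finite \<R>" "disjoint \<R>" "\<R> \<subseteq> {half_open_box x y | x y. cube_corners x y}"
  shows "\<Union>\<R> \<in> box_algebra"
  using assms by (auto simp: box_algebra_def)

lemma box_algebra_disjoint_Un:
  assumes "S \<in> box_algebra" "T \<in> box_algebra" "S \<inter> T = {}"
  shows "S \<union> T \<in> box_algebra"
proof -
  obtain \<R> where R: "S = \<Union>\<R>" "finite \<R>" "disjoint \<R>" "\<R> \<subseteq> {half_open_box x y | x y. cube_corners x y}"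
    using assms(1) by (auto simp: box_algebra_def)
  obtain \<T> where T: "T = \<Union>\<T>" "finite \<T>" "disjoint \<T>" "\<T> \<subseteq> {half_open_box x y | x y. cube_corners x y}"
    using assms(2) by (auto simp: box_algebra_def)
  have "disjoint (\<R> \<union> \<T>)"
    using R(3) T(3) assms(3) R(1) T(1) by (intro disjoint_union) auto
  then have "\<Union>(\<R> \<union> \<T>) \<in> box_algebra"
    using R T by (intro box_algebra_Union) auto
  then show ?thesis
    using R(1) T(1) by simp
qed

lemma box_algebra_fmeasurable: "S \<in> box_algebra \<Longrightarrow> S \<in> fmeasurable lborel"
  by (auto simp: box_algebra_def intro!: fmeasurable.finite_Union half_open_box_fmeasurable)

text \<open>
  This gives the uniqueness that the definite description in \<open>induced_measure\<close> asks for, so that any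
  additive function with the right values on boxes can be used in its place.
\<close>

lemma additive_box_algebra_unique:
  assumes "additive box_algebra \<mu>" "additive box_algebra \<mu>'"
    and "\<And>x y. cube_corners x y \<Longrightarrow> \<mu> (half_open_box x y) = \<mu>' (half_open_box x y)"
    and "S \<in> box_algebra"
  shows "\<mu> S = (\<mu>' S :: real)"
proof -
  have emp: "{} \<in> box_algebra"
    using box_algebra_Union[of "{}"] by simp
  have eq0: "\<nu> {} = 0" if "additive box_algebra \<nu>" for \<nu> :: "(real^'n) set \<Rightarrow> real"
    using additiveD[OF that, of "{}" "{}"] emp by simp
  obtain \<R> where R: "S = \<Union>\<R>" "finite \<R>" "disjoint \<R>" "\<R> \<subseteq> {half_open_box x y | x y. cube_corners x y}"
    using assms(4) by (auto simp: box_algebra_def)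
  have "\<mu> (\<Union>\<R>) = \<mu>' (\<Union>\<R>)"
    using R(2-4)
  proof (induction \<R> rule: finite_induct)
    case empty
    then show ?case using eq0[OF assms(1)] eq0[OF assms(2)] by simp
  next
    case (insert B \<R>)
    from insert.prems obtain x y where B: "B = half_open_box x y" "cube_corners x y" by auto
    have d: "disjoint \<R>" "B \<inter> \<Union>\<R> = {}"
      using insert.prems(1) insert.hyps(2) by (auto simp: disjoint_def)
    have BA: "B \<in> box_algebra"
      using box_algebra_Union[of "{B}"] B by (auto simp: disjoint_def)
    have RA: "\<Union>\<R> \<in> box_algebra"
      using insert d(1) by (intro box_algebra_Union) auto
    have "\<mu> (\<Union>\<R>) = \<mu>' (\<Union>\<R>)"
      using insert d by auto
    then show ?case
      using additiveD[OF assms(1) d(2) BA RA] additiveD[OF assms(2) d(2) BA RA] assms(3)[OF B(2)] B(1)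
      by simp
  qed
  then show ?thesis using R(1) by simp
qed

lemma induced_measure_eqI:
  assumes "additive box_algebra \<mu>"
    and "\<And>x y. cube_corners x y \<Longrightarrow> \<mu> (half_open_box x y) = box_volume Q x y"
    and "S \<in> box_algebra"
  shows "induced_measure Q S = \<mu> S"
proof -
  define \<mu>' where "\<mu>' = restrict \<mu> box_algebra"
  have add: "additive box_algebra \<mu>'"
    using assms(1) box_algebra_disjoint_Un by (auto simp: additive_def \<mu>'_def)
  have box: "half_open_box x y \<in> box_algebra" if "cube_corners x y" for x y :: "real ^ 'n"
    using box_algebra_Union[of "{half_open_box x y}"] that by (auto simp: disjoint_def)
  have vol: "\<mu>' (half_open_box x y) = box_volume Q x y" if "cube_corners x y" for x y
    using assms(2)[OF that] box[OF that] by (simp add: \<mu>'_def)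
  have "induced_measure Q = \<mu>'"
    unfolding induced_measure_def
  proof (rule the_equality)
    show "\<mu>' \<in> extensional box_algebra \<and> additive box_algebra \<mu>' \<and>
      (\<forall>x y. cube_corners x y \<longrightarrow> \<mu>' (half_open_box x y) = box_volume Q x y)"
      using add vol by (simp add: \<mu>'_def)
  next
    fix \<rho> assume \<rho>: "\<rho> \<in> extensional box_algebra \<and> additive box_algebra \<rho> \<and>
      (\<forall>x y. cube_corners x y \<longrightarrow> \<rho> (half_open_box x y) = box_volume Q x y)"
    show "\<rho> = \<mu>'"
    proof (rule extensionalityI)
      show "\<rho> \<in> extensional box_algebra" "\<mu>' \<in> extensional box_algebra"
        using \<rho> by (auto simp: \<mu>'_def)
      show "\<rho> S = \<mu>' S" if "S \<in> box_algebra" for S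
        using additive_box_algebra_unique[OF _ add _ that, of \<rho>] \<rho> vol by auto
    qed
  qed
  then show ?thesis
    using assms(3) by (simp add: \<mu>'_def)
qed

lemma box_volume_sum:
  "box_volume (\<lambda>v. \<Sum>c\<in>C. \<nu> c * F c v) x y = (\<Sum>c\<in>C. \<nu> c * box_volume (F c) x y)"
  unfolding box_volume_def
  by (simp add: sum_distrib_left mult.left_commute) (rule sum.swap)

lemma box_volume_cong:
  assumes "cube_corners x y" "\<And>u. u \<in> cbox 0 1 \<Longrightarrow> A u = B u"
  shows "box_volume A x y = box_volume B x y"
  unfolding box_volume_def
proof (rule sum.cong)
  fix v assume "v \<in> {v. \<forall>j. v $ j \<in> {x $ j, y $ j}}"
  then have "\<forall>j. v $ j = x $ j \<or> v $ j = y $ j" by auto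
  then have "v \<in> cbox 0 1"
    using assms(1) by (auto simp: cube_corners_def mem_box_cart) (metis (no_types))+
  then show "(if even (card {j. v $ j = x $ j}) then 1 else - 1) * A v = (if even (card {j. v $ j = x $ j}) then 1 else - 1) * B v"
    using assms(2) by simp
qed simp

text \<open>
  Expanding the product of differences gives one term for each subset of the axes, namely for the
  vertex of the box that takes its lower coordinate exactly on this subset.
\<close>

lemma box_volume_prod:
  fixes F :: "'n::finite \<Rightarrow> real \<Rightarrow> real"
  assumes "\<And>k. x $ k < y $ k"
  shows "box_volume (\<lambda>v. \<Prod>k\<in>UNIV. F k (v $ k)) x y = (\<Prod>k\<in>UNIV. F k (y $ k) - F k (x $ k))"
proof -
  have ne: "x $ k \<noteq> y $ k" for k using assms[of k] by simp
  let ?v = "\<lambda>X. (\<chi> j. if j \<in> X then x $ j else y $ j)"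
  have "box_volume (\<lambda>v. \<Prod>k\<in>UNIV. F k (v $ k)) x y
    = (\<Sum>X\<in>Pow UNIV. (- 1) ^ card X * (\<Prod>k\<in>X. F k (x $ k)) * (\<Prod>k\<in>UNIV - X. F k (y $ k)))"
    unfolding box_volume_def
  proof (rule sum.reindex_bij_witness[of _ ?v "\<lambda>v. {j. v $ j = x $ j}"])
    fix v assume v: "v \<in> {v. \<forall>j. v $ j \<in> {x $ j, y $ j}}"
    show "?v {j. v $ j = x $ j} = v" using v by (auto simp: vec_eq_iff)
    let ?X = "{j. v $ j = x $ j}"
    have "(\<Prod>k\<in>UNIV. F k (v $ k)) = (\<Prod>k\<in>?X. F k (v $ k)) * (\<Prod>k\<in>UNIV - ?X. F k (v $ k))"
      by (subst prod.subset_diff[of ?X]) (auto simp: mult.commute)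
    moreover have "(\<Prod>k\<in>?X. F k (v $ k)) = (\<Prod>k\<in>?X. F k (x $ k))" by (rule prod.cong) auto
    moreover have "(\<Prod>k\<in>UNIV - ?X. F k (v $ k)) = (\<Prod>k\<in>UNIV - ?X. F k (y $ k))"
      using v by (intro prod.cong) auto
    ultimately show "(- 1) ^ card ?X * (\<Prod>k\<in>?X. F k (x $ k)) * (\<Prod>k\<in>UNIV - ?X. F k (y $ k)) =
         (if even (card ?X) then 1 else - 1) * (\<Prod>k\<in>UNIV. F k (v $ k))"
      by (auto simp: minus_one_power_iff)
  next
    fix X :: "'n set" assume "X \<in> Pow UNIV"
    show "{j. ?v X $ j = x $ j} = X" using ne by (auto split: if_splits) metis+
    show "?v X \<in> {v. \<forall>j. v $ j \<in> {x $ j, y $ j}}" by auto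
  qed auto
  also have "\<dots> = (\<Prod>k\<in>UNIV. F k (y $ k) - F k (x $ k))"
    by (rule prod_diff_conv_sum[symmetric]) simp
  finally show ?thesis .
qed

section \<open>Shuffles of piecewise uniform signed measures\<close>

text \<open>
  The distribution function of the uniform distribution on the \<open>i\<close>-th of \<open>N\<close> equal intervals;
  cells and intervals are counted from 0.
\<close>

definition ramp :: "nat \<Rightarrow> nat \<Rightarrow> real \<Rightarrow> real" where
  "ramp N i t = max 0 (min 1 (real N * t - real i))"

definition cell :: "nat \<Rightarrow> ('n \<Rightarrow> nat) \<Rightarrow> (real ^ 'n) set" where
  "cell N c = half_open_box (\<chi> k. real (c k) / real N) (\<chi> k. (real (c k) + 1) / real N)"

definition cell_measure :: "nat \<Rightarrow> (('n::finite \<Rightarrow> nat) \<Rightarrow> real) \<Rightarrow> (real ^ 'n) set \<Rightarrow> real" where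
  "cell_measure N \<nu> S =
     (\<Sum>c\<in>UNIV \<rightarrow>\<^sub>E {..<N}. \<nu> c * (real N ^ CARD('n) * measure lborel (S \<inter> cell N c)))"

text \<open>
  The function with \<open>\<pi> = (\<lambda>e. e)\<close> is the distribution function of \<open>cell_measure N \<nu>\<close>; for another
  \<open>\<pi>\<close>, the mass \<open>\<nu> c\<close> sits on the cell to which \<open>\<pi>\<close> moves \<open>c\<close> along every axis.
\<close>

definition cell_cdf :: "nat \<Rightarrow> (('n::finite \<Rightarrow> nat) \<Rightarrow> real) \<Rightarrow> (nat \<Rightarrow> nat) \<Rightarrow> real ^ 'n \<Rightarrow> real" where
  "cell_cdf N \<nu> \<pi> x = (\<Sum>c\<in>UNIV \<rightarrow>\<^sub>E {..<N}. \<nu> c * (\<Prod>k\<in>UNIV. ramp N (\<pi> (c k)) (x $ k)))"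

lemma ramp_increment_eq_overlap:
  assumes "N > 0" "x \<le> y"
  shows "real N * max 0 (min y ((real e + 1) / real N) - max x (real e / real N)) = ramp N e y - ramp N e x"
proof -
  have N: "real N > 0" using assms(1) by simp
  have "real N * max 0 (min y ((real e + 1) / real N) - max x (real e / real N))
     = max 0 (min (real N * y) (real e + 1) - max (real N * x) (real e))"
    using N by (simp add: max_mult_distrib_left min_mult_distrib_left right_diff_distrib)
  also have "\<dots> = ramp N e y - ramp N e x"
  proof -
    have "max 0 (min b (u + 1) - max a u) = max 0 (min 1 (b - u)) - max 0 (min 1 (a - u))"
      if "a \<le> b" for a b u :: real
      using that by (auto simp: max_def min_def)
    then show ?thesis
      using assms N by (simp add: ramp_def)
  qed
  finally show ?thesis .
qed

lemma scaled_measure_half_open_box_cell: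
  fixes x y :: "real ^ 'n"
  assumes "N > 0" "\<And>k. x $ k \<le> y $ k"
  shows "real N ^ CARD('n) * measure lborel (half_open_box x y \<inter> cell N c)
    = (\<Prod>k\<in>UNIV. ramp N (c k) (y $ k) - ramp N (c k) (x $ k))"
proof -
  have "real N ^ CARD('n) = (\<Prod>k\<in>(UNIV::'n set). real N)" by simp
  then show ?thesis
    unfolding cell_def half_open_box_Int measure_half_open_box
    using ramp_increment_eq_overlap[OF assms] by (simp only: prod.distrib[symmetric] vec_lambda_beta)
qed

lemma cell_measure_additive:
  fixes \<nu> :: "('n::finite \<Rightarrow> nat) \<Rightarrow> real"
  shows "additive box_algebra (cell_measure N \<nu>)"
  unfolding additive_def
proof (intro ballI impI)
  fix S T :: "(real ^ 'n) set" assume ST: "S \<in> box_algebra" "T \<in> box_algebra" "S \<inter> T = {}"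
  have "R \<inter> cell N c \<in> fmeasurable lborel" if "R \<in> box_algebra" for R c
    unfolding cell_def using box_algebra_fmeasurable[OF that] half_open_box_fmeasurable by (intro fmeasurable.Int) auto
  then have "measure lborel ((S \<union> T) \<inter> cell N c) = measure lborel (S \<inter> cell N c) + measure lborel (T \<inter> cell N c)" for c
    unfolding Int_Un_distrib2 using ST
    by (intro measure_Un_AE) auto
  then show "cell_measure N \<nu> (S \<union> T) = cell_measure N \<nu> S + cell_measure N \<nu> T"
    by (simp add: cell_measure_def algebra_simps sum.distrib)
qed

lemma induced_measure_cell_cdf:
  fixes A :: "real ^ 'n \<Rightarrow> real"
  assumes N: "N > 0" and A: "\<And>x. x \<in> cbox 0 1 \<Longrightarrow> A x = cell_cdf N \<nu> (\<lambda>i. i) x"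
    and S: "S \<in> box_algebra"
  shows "induced_measure A S = cell_measure N \<nu> S"
proof (rule induced_measure_eqI[OF cell_measure_additive _ S])
  fix x y :: "real ^ 'n" assume xy: "cube_corners x y"
  then have lt: "x $ k < y $ k" for k by (simp add: cube_corners_def)
  have "box_volume A x y = box_volume (cell_cdf N \<nu> (\<lambda>i. i)) x y"
    using xy A by (rule box_volume_cong)
  also have "\<dots> = (\<Sum>c\<in>UNIV \<rightarrow>\<^sub>E {..<N}. \<nu> c * box_volume (\<lambda>x. \<Prod>k\<in>UNIV. ramp N (c k) (x $ k)) x y)"
    unfolding cell_cdf_def by (rule box_volume_sum)
  also have "\<dots> = cell_measure N \<nu> (half_open_box x y)"
    unfolding cell_measure_def
    using box_volume_prod[OF lt, where F = "\<lambda>k. ramp N (_ k)"]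
      scaled_measure_half_open_box_cell[OF N, of x y] lt by (auto intro!: sum.cong simp: less_imp_le)
  finally show "cell_measure N \<nu> (half_open_box x y) = box_volume A x y" ..
qed

lemma cells_disjoint:
  assumes "N > 0" "t \<in> cell N c" "t \<in> cell N c'"
  shows "c = c'"
proof
  fix k
  have "real (c k) < real N * t $ k" "real N * t $ k \<le> real (c k) + 1"
    "real (c' k) < real N * t $ k" "real N * t $ k \<le> real (c' k) + 1"
    using assms by (auto simp: cell_def half_open_box_def field_simps)
  then show "c k = c' k" by linarith
qed

lemma cells_cover:
  assumes "N > 0" "\<And>k. 0 < t $ k" "\<And>k. t $ k \<le> 1"
  shows "\<exists>c\<in>UNIV \<rightarrow>\<^sub>E {..<N}. t \<in> cell N c"
proof -
  have "\<exists>e<N. real e < real N * t $ k \<and> real N * t $ k \<le> real e + 1" for k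
  proof -
    define e where "e = nat (\<lceil>real N * t $ k\<rceil> - 1)"
    have pos: "0 < real N * t $ k" using assms by simp
    have le: "real N * t $ k \<le> real N" using assms by (simp add: mult_left_le)
    have "\<lceil>real N * t $ k\<rceil> > 0" using pos by simp
    moreover have "\<lceil>real N * t $ k\<rceil> \<le> int N" using le by (simp add: ceiling_le_iff)
    moreover from calculation have "int e = \<lceil>real N * t $ k\<rceil> - 1" by (simp add: e_def)
    moreover from calculation have "e < N" by linarith
    ultimately show ?thesis by (intro exI[of _ e]) linarith
  qed
  then obtain c where "\<And>k. c k < N \<and> real (c k) < real N * t $ k \<and> real N * t $ k \<le> real (c k) + 1"
    by metis
  then show ?thesis
    using assms(1) by (intro bexI[of _ c]) (auto simp: cell_def half_open_box_def field_simps)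
qed

text \<open>
  For intervals of equal length the shuffle map is a translation on each of them: the intervals
  placed before the image of the \<open>e\<close>-th one are \<open>\<pi> e\<close> in number.  The shift between \<open>p\<close> and \<open>\<pi>\<close>
  reconciles intervals counted from 1 with cells counted from 0.
\<close>

lemma shuffle_map_equidistant:
  assumes \<pi>: "bij_betw \<pi> {..<N} {..<N}" and e: "e < N"
    and t: "real e / real N < t" "t \<le> (real e + 1) / real N"
    and p: "\<And>j. p j = (if j \<in> {1..N} then Suc (\<pi> (j - 1)) else j)"
  shows "shuffle_map N (\<lambda>j. real j / real N) p t = t - real e / real N + real (\<pi> e) / real N"
proof -
  have N: "real N > 0" using e by simp
  have t': "real e < real N * t" "real N * t \<le> real e + 1" using t N by (auto simp: field_simps)
  have pos: "t > 0" using t(1) N by (meson divide_nonneg_pos le_less_trans of_nat_0_le_iff)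
  have "(THE i. i \<in> {1..N} \<and> t \<in> {real (i - 1) / real N<..real i / real N}) = Suc e"
  proof (rule the_equality)
    show "Suc e \<in> {1..N} \<and> t \<in> {real (Suc e - 1) / real N<..real (Suc e) / real N}"
      using e t by (auto simp: add.commute)
    fix i assume i: "i \<in> {1..N} \<and> t \<in> {real (i - 1) / real N<..real i / real N}"
    then have "real (i - 1) < real N * t" "real N * t \<le> real i" using N by (auto simp: field_simps)
    then show "i = Suc e" using i t' by linarith
  qed
  moreover have "(\<Sum>j | j \<in> {1..N} \<and> p j < p (Suc e). measure lborel {real (j - 1) / real N<..real j / real N})
      = real (\<pi> e) / real N"
  proof -
    let ?J = "{j. j \<in> {1..N} \<and> p j < p (Suc e)}"
    have "(\<Sum>j\<in>?J. measure lborel {real (j - 1) / real N<..real j / real N}) = (\<Sum>j\<in>?J. 1 / real N)"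
      by (intro sum.cong) (auto simp: measure_lborel_Ioc divide_right_mono of_nat_diff diff_divide_distrib)
    moreover have "bij_betw (\<lambda>j. \<pi> (j - 1)) ?J {..<\<pi> e}"
    proof -
      have "bij_betw (\<lambda>j. j - 1) ?J {i\<in>{..<N}. \<pi> i < \<pi> e}"
        using e by (intro bij_betw_byWitness[of _ Suc]) (auto simp: p)
      moreover have "bij_betw \<pi> {i\<in>{..<N}. \<pi> i < \<pi> e} {..<\<pi> e}"
      proof -
        have "\<pi> e < N" using \<pi> e by (auto simp: bij_betw_def)
        then have "{..<\<pi> e} = \<pi> ` {i\<in>{..<N}. \<pi> i < \<pi> e}"
          using \<pi> by (auto simp: bij_betw_def set_eq_iff image_iff) (metis imageE lessThan_iff less_trans)
        then show ?thesis
          using \<pi> by (auto simp: bij_betw_def inj_on_def)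
      qed
      ultimately show ?thesis
        using bij_betw_trans[of "\<lambda>j. j - 1" ?J "{i\<in>{..<N}. \<pi> i < \<pi> e}" \<pi> "{..<\<pi> e}"] by (simp add: comp_def)
    qed
    then have "card ?J = \<pi> e" using bij_betw_same_card by fastforce
    ultimately show ?thesis by simp
  qed
  ultimately show ?thesis
    using pos by (simp add: shuffle_map_def)
qed

text \<open>
  Inside a cell the preimage of a box \<open>(0, x]\<close> under the shuffle is again a box with the same lower corner as the cell;
  its share of the cell along axis \<open>k\<close> is the share of the image cell that lies below \<open>x $ k\<close>,
  which is what \<open>ramp N (\<pi> (c k))\<close> measures.
\<close>

lemma is_shuffle_of_cell_cdf:
  fixes A A' :: "real ^ 'n \<Rightarrow> real"
  assumes N: "N > 0" and \<pi>: "bij_betw \<pi> {..<N} {..<N}"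
    and A: "\<And>x. x \<in> cbox 0 1 \<Longrightarrow> A x = cell_cdf N \<nu> (\<lambda>i. i) x"
    and A': "\<And>x. x \<in> cbox 0 1 \<Longrightarrow> A' x = cell_cdf N \<nu> \<pi> x"
  shows "is_shuffle_of A' A"
proof -
  define p where "p j = (if j \<in> {1..N} then Suc (\<pi> (j - 1)) else j)" for j
  have Npos: "real N > 0" using N by simp
  have perm: "p permutes {1..N}"
  proof (rule bij_imp_permutes)
    have pred: "bij_betw (\<lambda>j. j - 1) {1..N} {..<N}"
      by (intro bij_betw_byWitness[of _ Suc]) auto
    have succ: "bij_betw Suc {..<N} {1..N}"
      by (intro bij_betw_byWitness[of _ "\<lambda>j. j - 1"]) auto
    have "bij_betw (\<lambda>j. Suc (\<pi> (j - 1))) {1..N} {1..N}"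
      using bij_betw_trans[OF pred bij_betw_trans[OF \<pi> succ]] by (simp add: comp_def)
    then show "bij_betw p {1..N} {1..N}"
      by (subst bij_betw_cong[where g = "\<lambda>j. Suc (\<pi> (j - 1))"]) (simp_all add: p_def)
  qed (auto simp: p_def)
  have part: "unit_partition N (\<lambda>j. real j / real N)"
    using N by (auto simp: unit_partition_def divide_right_mono)
  have "A' x = induced_measure A
      {t \<in> cbox 0 1. (\<chi> k. shuffle_map N (\<lambda>j. real j / real N) p (t $ k)) \<in> half_open_box 0 x}"
    if x: "x \<in> cbox 0 1" for x
  proof -
    let ?C = "UNIV \<rightarrow>\<^sub>E {..<N} :: ('n \<Rightarrow> nat) set"
    let ?P = "{t \<in> cbox 0 1. (\<chi> k. shuffle_map N (\<lambda>j. real j / real N) p (t $ k)) \<in> half_open_box 0 x}"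
    define b where "b c = (\<chi> k. (real (c k) + ramp N (\<pi> (c k)) (x $ k)) / real N)" for c
    define B where "B c = half_open_box (\<chi> k. real (c k) / real N) (b c)" for c :: "'n \<Rightarrow> nat"
    have ramp01: "0 \<le> ramp N i t" "ramp N i t \<le> 1" for i t by (auto simp: ramp_def)
    have Int: "?P \<inter> cell N c = B c" if c: "c \<in> ?C" for c
    proof -
      have cN: "c k < N" for k using c by (auto simp: PiE_iff)
      have "(t \<in> ?P \<and> t \<in> cell N c) = (t \<in> B c)" for t
      proof (cases "t \<in> cell N c")
        case True
        have bnd: "real (c k) / real N < t $ k" "t $ k \<le> (real (c k) + 1) / real N" for k
          using True by (auto simp: cell_def half_open_box_def)
        have sm: "shuffle_map N (\<lambda>j. real j / real N) p (t $ k) = t $ k - real (c k) / real N + real (\<pi> (c k)) / real N" for k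
          by (rule shuffle_map_equidistant[OF \<pi> cN bnd p_def])
        have bnd': "real (c k) < real N * t $ k" "real N * t $ k \<le> real (c k) + 1" for k
          using bnd[of k] Npos by (auto simp: field_simps)
        have pos: "0 < t $ k" for k using bnd'(1)[of k] Npos
          by (metis le_less_trans of_nat_0_le_iff zero_less_mult_pos)
        have le1: "t $ k \<le> 1" for k
        proof -
          have "real (c k) + 1 \<le> real N" using cN[of k] by simp
          then have "real N * t $ k \<le> real N * 1" using bnd'(2)[of k] by linarith
          then show ?thesis using Npos by (simp only: mult_le_cancel_left_pos)
        qed
        have cube: "t \<in> cbox 0 1" using pos le1 by (simp add: mem_box_cart less_imp_le)
        have "(0 < t $ k - real (c k) / real N + real (\<pi> (c k)) / real N \<and>
               t $ k - real (c k) / real N + real (\<pi> (c k)) / real N \<le> x $ k) \<longleftrightarrow>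
              t $ k \<le> (real (c k) + ramp N (\<pi> (c k)) (x $ k)) / real N" for k
        proof -
          have "0 < t $ k - real (c k) / real N + real (\<pi> (c k)) / real N"
            using bnd(1)[of k] by (simp add: add_pos_nonneg)
          moreover have "t $ k - real (c k) / real N + real (\<pi> (c k)) / real N \<le> x $ k \<longleftrightarrow>
            real N * t $ k - real (c k) \<le> real N * x $ k - real (\<pi> (c k))"
            using Npos by (simp add: field_simps)
          moreover have "t $ k \<le> (real (c k) + ramp N (\<pi> (c k)) (x $ k)) / real N \<longleftrightarrow>
            real N * t $ k - real (c k) \<le> ramp N (\<pi> (c k)) (x $ k)"
            using Npos by (simp add: field_simps)
          moreover have "real N * t $ k - real (c k) \<le> ramp N (\<pi> (c k)) (x $ k) \<longleftrightarrow>
            real N * t $ k - real (c k) \<le> real N * x $ k - real (\<pi> (c k))"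
            using bnd'[of k] unfolding ramp_def by linarith
          ultimately show ?thesis by simp
        qed
        then show ?thesis
          using True cube bnd by (simp add: half_open_box_def sm B_def b_def)
      next
        case False
        then obtain k where k: "\<not> (real (c k) / real N < t $ k \<and> t $ k \<le> (real (c k) + 1) / real N)"
          by (auto simp: cell_def half_open_box_def)
        have "(real (c k) + ramp N (\<pi> (c k)) (x $ k)) / real N \<le> (real (c k) + 1) / real N"
          using ramp01 by (simp add: divide_right_mono)
        then have "t \<notin> B c"
          using k by (auto simp: B_def b_def half_open_box_def intro!: exI[of _ k])
        then show ?thesis using False by simp
      qed
      then show ?thesis by blast
    qed
    have cover: "\<exists>c\<in>?C. t \<in> cell N c" if t: "t \<in> ?P" for t
    proof (rule cells_cover[OF N])
      fix k
      have "0 < shuffle_map N (\<lambda>j. real j / real N) p (t $ k)"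
        using t by (simp add: half_open_box_def)
      then have "t $ k \<noteq> 0" by (auto simp: shuffle_map_def)
      then show "0 < t $ k" "t $ k \<le> 1"
        using t by (auto simp: mem_box_cart order_le_less)
    qed
    \<comment> \<open>Cells whose image does not meet the box are dropped, as the boxes of the algebra must be nondegenerate.\<close>
    define C where "C = {c\<in>?C. \<forall>k. ramp N (\<pi> (c k)) (x $ k) > 0}"
    have P: "?P = \<Union>(B ` C)"
    proof
      show "?P \<subseteq> \<Union>(B ` C)"
      proof
        fix t assume t: "t \<in> ?P"
        then obtain c where c: "c \<in> ?C" "t \<in> cell N c" using cover by blast
        then have tB: "t \<in> B c" using Int t by blast
        have "ramp N (\<pi> (c k)) (x $ k) > 0" for k
        proof -
          have "real (c k) / real N < (real (c k) + ramp N (\<pi> (c k)) (x $ k)) / real N"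
            using tB by (auto simp: B_def b_def half_open_box_def intro: less_le_trans)
          then show ?thesis using Npos by (simp add: divide_less_cancel)
        qed
        then show "t \<in> \<Union>(B ` C)" using c tB by (auto simp: C_def)
      qed
      show "\<Union>(B ` C) \<subseteq> ?P"
        using Int by (auto simp: C_def simp del: mem_Collect_eq)
    qed
    have "\<Union>(B ` C) \<in> box_algebra"
    proof (rule box_algebra_Union)
      show "finite (B ` C)" by (simp add: C_def finite_PiE)
      show "disjoint (B ` C)"
      proof (rule disjointI)
        fix X Y assume "X \<in> B ` C" "Y \<in> B ` C" "X \<noteq> Y"
        then obtain c c' where c: "X = B c" "Y = B c'" "c \<in> ?C" "c' \<in> ?C" "c \<noteq> c'" by (auto simp: C_def)
        then show "X \<inter> Y = {}"
          using Int[of c] Int[of c'] cells_disjoint[OF N, of _ c c'] by blast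
      qed
      show "B ` C \<subseteq> {half_open_box x y | x y. cube_corners x y}"
      proof clarify
        fix c assume c: "c \<in> C"
        have "cube_corners (\<chi> k. real (c k) / real N) (b c)"
        proof -
          have "real (c k) + ramp N (\<pi> (c k)) (x $ k) \<le> real N" for k
          proof -
            have "c k < N" using c by (auto simp: C_def PiE_iff)
            then have "real (c k) + 1 \<le> real N" by simp
            then show ?thesis using ramp01(2)[of "\<pi> (c k)" "x $ k"] by linarith
          qed
          moreover have "0 < ramp N (\<pi> (c k)) (x $ k)" for k using c by (simp add: C_def)
          moreover have "c k < N" for k using c by (auto simp: C_def PiE_iff)
          ultimately show ?thesis
            using Npos by (auto simp: cube_corners_def b_def mem_box_cart divide_strict_right_mono less_imp_le add_nonneg_nonneg)
        qed
        then show "\<exists>u v. B c = half_open_box u v \<and> cube_corners u v"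
          by (auto simp: B_def)
      qed
    qed
    then have "induced_measure A ?P = cell_measure N \<nu> ?P"
      unfolding P by (intro induced_measure_cell_cdf[OF N A])
    also have "\<dots> = cell_cdf N \<nu> \<pi> x"
      unfolding cell_measure_def cell_cdf_def
    proof (intro sum.cong refl arg_cong2[where f = "(*)"])
      fix c assume c: "c \<in> ?C"
      have "measure lborel (?P \<inter> cell N c) = (\<Prod>k\<in>(UNIV::'n set). ramp N (\<pi> (c k)) (x $ k) / real N)"
        unfolding Int[OF c] B_def measure_half_open_box
        using ramp01(1) Npos by (intro prod.cong) (auto simp: b_def add_divide_distrib)
      then show "real N ^ CARD('n) * measure lborel (?P \<inter> cell N c) = (\<Prod>k\<in>UNIV. ramp N (\<pi> (c k)) (x $ k))"
        using Npos by (simp add: prod_dividef)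
    qed
    finally show ?thesis using A'[OF x] by simp
  qed
  then show ?thesis
    unfolding is_shuffle_of_def using perm part
    by (intro exI[of _ "\<lambda>_. N"] exI[of _ "\<lambda>_ j. real j / real N"] exI[of _ "\<lambda>_. p"]) auto
qed

section \<open>Quasi-copulas, one coordinate at a time\<close>

definition upd :: "real ^ 'n \<Rightarrow> 'n \<Rightarrow> real \<Rightarrow> real ^ 'n" where
  "upd x k t = (\<chi> i. if i = k then t else x $ i)"

lemma upd_nth [simp]: "upd x k t $ i = (if i = k then t else x $ i)"
  by (simp add: upd_def)

lemma upd_self [simp]: "upd x k (x $ k) = x"
  by (simp add: vec_eq_iff)

lemma upd_one: "upd 1 k t = (\<chi> i. if i = k then t else 1)"
  by (simp add: vec_eq_iff)

lemma upd_cube: "x \<in> cbox 0 1 \<Longrightarrow> 0 \<le> t \<Longrightarrow> t \<le> 1 \<Longrightarrow> upd x k t \<in> cbox 0 1"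
  by (simp add: mem_box_cart)

lemma one_cube: "(1 :: real ^ 'n) \<in> cbox 0 1"
  by (simp add: mem_box_cart)

lemma prod_upd:
  "(\<Prod>i\<in>UNIV. f (upd x k t $ i)) = f t * (\<Prod>i\<in>-{k}. f (x $ i :: real) :: real)" for k :: "'n::finite"
proof -
  have "(\<Prod>i\<in>UNIV. f (upd x k t $ i)) = f (upd x k t $ k) * (\<Prod>i\<in>UNIV-{k}. f (upd x k t $ i))"
    by (rule prod.remove) auto
  then show ?thesis by (simp add: Compl_eq_Diff_UNIV)
qed

text \<open>
  Passing from \<open>u\<close> to \<open>v\<close> by changing one coordinate after the other reduces global monotonicity and
  Lipschitz bounds to increments in a single coordinate; \<open>J\<close> is the set of coordinates already changed.
\<close>

lemma coordinatewise_induct: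
  fixes u v :: "real ^ 'n"
  assumes "u \<in> cbox 0 1" "v \<in> cbox 0 1" "P u {}"
    and "\<And>w j J. w \<in> cbox 0 1 \<Longrightarrow> j \<notin> J \<Longrightarrow> w $ j = u $ j \<Longrightarrow> P w J \<Longrightarrow> P (upd w j (v $ j)) (insert j J)"
  shows "P v UNIV"
proof -
  have "finite J \<Longrightarrow> P (\<chi> i. if i \<in> J then v $ i else u $ i) J" for J :: "'n set"
  proof (induction J rule: finite_induct)
    case empty
    then show ?case using assms(3) by (simp add: vec_nth_inverse)
  next
    case (insert j J)
    have "P (upd (\<chi> i. if i \<in> J then v $ i else u $ i) j (v $ j)) (insert j J)"
      using insert assms(1,2) by (intro assms(4)) (auto simp: mem_box_cart)
    moreover have "upd (\<chi> i. if i \<in> J then v $ i else u $ i) j (v $ j) = (\<chi> i. if i \<in> insert j J then v $ i else u $ i)"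
      by (auto simp: vec_eq_iff)
    ultimately show ?case by simp
  qed
  from this[of UNIV] show ?thesis by simp
qed

lemma quasi_copulaD:
  assumes "quasi_copula A"
  shows quasi_copula_margin: "0 \<le> t \<Longrightarrow> t \<le> 1 \<Longrightarrow> A (upd 1 k t) = t"
    and quasi_copula_incr_nonneg: "x \<in> cbox 0 1 \<Longrightarrow> 0 \<le> s \<Longrightarrow> s \<le> t \<Longrightarrow> t \<le> 1 \<Longrightarrow> A (upd x k s) \<le> A (upd x k t)"
    and quasi_copula_incr_le: "x \<in> cbox 0 1 \<Longrightarrow> 0 \<le> s \<Longrightarrow> s \<le> t \<Longrightarrow> t \<le> 1 \<Longrightarrow> A (upd x k t) - A (upd x k s) \<le> t - s"
    and quasi_copula_lipschitz: "x \<in> cbox 0 1 \<Longrightarrow> y \<in> cbox 0 1 \<Longrightarrow> \<bar>A y - A x\<bar> \<le> (\<Sum>j\<in>UNIV. \<bar>y $ j - x $ j\<bar>)"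
    and quasi_copula_nonneg: "x \<in> cbox 0 1 \<Longrightarrow> 0 \<le> A x"
    and quasi_copula_le_one: "x \<in> cbox 0 1 \<Longrightarrow> A x \<le> 1"
proof -
  note q = assms[unfolded quasi_copula_def]
  show mar: "A (upd 1 k t) = t" if "0 \<le> t" "t \<le> 1" for k t
    using q that by (simp add: upd_one)
  show "A (upd x k s) \<le> A (upd x k t)" if "x \<in> cbox 0 1" "0 \<le> s" "s \<le> t" "t \<le> 1" for x k s t
  proof -
    have "A (upd x k s) \<le> A (\<chi> i. if i = k then t else upd x k s $ i)"
      using q that by (auto simp: mem_box_cart)
    also have "(\<chi> i. if i = k then t else upd x k s $ i) = upd x k t" by (simp add: vec_eq_iff)
    finally show ?thesis .
  qed
  show lip: "\<bar>A y - A x\<bar> \<le> (\<Sum>j\<in>UNIV. \<bar>y $ j - x $ j\<bar>)" if "x \<in> cbox 0 1" "y \<in> cbox 0 1" for x y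
    using q that by blast
  show "A (upd x k t) - A (upd x k s) \<le> t - s" if "x \<in> cbox 0 1" "0 \<le> s" "s \<le> t" "t \<le> 1" for x k s t
  proof -
    have "\<bar>A (upd x k t) - A (upd x k s)\<bar> \<le> (\<Sum>j\<in>UNIV. \<bar>upd x k t $ j - upd x k s $ j\<bar>)"
      using that by (intro lip upd_cube) auto
    also have "\<dots> = (\<Sum>j\<in>UNIV. if j = k then t - s else 0)"
      using that by (intro sum.cong) auto
    finally show ?thesis by simp
  qed
  show "0 \<le> A x" "A x \<le> 1" if "x \<in> cbox 0 1" for x using q that by auto
qed

lemma quasi_copula_le_coordinate:
  fixes A :: "real ^ 'n \<Rightarrow> real"
  assumes A: "quasi_copula A" and x: "x \<in> cbox 0 1"
  shows "A x \<le> x $ k"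
proof -
  have "0 \<le> x $ k" "x $ k \<le> 1" using x by (auto simp: mem_box_cart)
  then have "A x \<le> A (upd 1 k (x $ k))"
  proof (intro coordinatewise_induct[of x "upd 1 k (x $ k)" "\<lambda>w J. A x \<le> A w"] upd_cube one_cube x)
    fix w :: "real ^ 'n" and j :: 'n and J assume w: "w \<in> cbox 0 1" "w $ j = x $ j" "A x \<le> A w"
    have "x $ j \<le> upd 1 k (x $ k) $ j" "0 \<le> x $ j" "upd 1 k (x $ k) $ j \<le> 1"
      using x by (auto simp: mem_box_cart)
    then have "A (upd w j (x $ j)) \<le> A (upd w j (upd 1 k (x $ k) $ j))"
      by (intro quasi_copula_incr_nonneg[OF A w(1)])
    moreover have "upd w j (x $ j) = w" using w(2) upd_self[of w j] by simp
    ultimately show "A x \<le> A (upd w j (upd 1 k (x $ k) $ j))" using w(3) by simp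
  qed auto
  then show ?thesis
    using quasi_copula_margin[OF A] \<open>0 \<le> x $ k\<close> \<open>x $ k \<le> 1\<close> by simp
qed

lemma quasi_copula_grounded:
  assumes "quasi_copula A" "x \<in> cbox 0 1" "x $ k = 0"
  shows "A x = 0"
  using quasi_copula_le_coordinate[OF assms(1,2), of k] quasi_copula_nonneg[OF assms(1,2)] assms(3) by simp

text \<open>
  All conditions on a quasi-copula follow from the margins, from the zeros on the lower faces and from bounds on
  increments in a single coordinate, which is the form in which they are verified below.
\<close>

lemma quasi_copulaI:
  fixes A :: "real ^ 'n \<Rightarrow> real"
  assumes mar: "\<And>k t. 0 \<le> t \<Longrightarrow> t \<le> 1 \<Longrightarrow> A (upd 1 k t) = t"
    and zero: "\<And>x k. x \<in> cbox 0 1 \<Longrightarrow> x $ k = 0 \<Longrightarrow> A x = 0"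
    and ge: "\<And>x k s t. x \<in> cbox 0 1 \<Longrightarrow> 0 \<le> s \<Longrightarrow> s \<le> t \<Longrightarrow> t \<le> 1 \<Longrightarrow> 0 \<le> A (upd x k t) - A (upd x k s)"
    and le: "\<And>x k s t. x \<in> cbox 0 1 \<Longrightarrow> 0 \<le> s \<Longrightarrow> s \<le> t \<Longrightarrow> t \<le> 1 \<Longrightarrow> A (upd x k t) - A (upd x k s) \<le> t - s"
  shows "quasi_copula A"
proof -
  have "A u \<in> {0..1}" if u: "u \<in> cbox 0 1" for u
  proof -
    fix k :: 'n
    have k: "0 \<le> u $ k" "u $ k \<le> 1" using u by (auto simp: mem_box_cart)
    have "A (upd u k 0) = 0" using u by (intro zero[of _ k] upd_cube) auto
    then show ?thesis
      using ge[OF u, of 0 "u $ k" k] le[OF u, of 0 "u $ k" k] k by auto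
  qed
  moreover have "A u \<le> A (\<chi> i. if i = j then t else u $ i)"
    if "u \<in> cbox 0 1" "t \<in> {0..1}" "u $ j \<le> t" for u j t
    using ge[of u "u $ j" t j] that by (auto simp: upd_def[symmetric] mem_box_cart)
  moreover have "\<bar>A v - A u\<bar> \<le> (\<Sum>j\<in>UNIV. \<bar>v $ j - u $ j\<bar>)" if uv: "u \<in> cbox 0 1" "v \<in> cbox 0 1" for u v
  proof (rule coordinatewise_induct[OF uv, where P = "\<lambda>w J. \<bar>A w - A u\<bar> \<le> (\<Sum>j\<in>J. \<bar>v $ j - u $ j\<bar>)"])
    fix w j J assume w: "w \<in> cbox 0 1" "j \<notin> J" "w $ j = u $ j" "\<bar>A w - A u\<bar> \<le> (\<Sum>j\<in>J. \<bar>v $ j - u $ j\<bar>)"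
    have b: "0 \<le> u $ j" "u $ j \<le> 1" "0 \<le> v $ j" "v $ j \<le> 1" using uv by (auto simp: mem_box_cart)
    have "upd w j (u $ j) = w" using w(3) upd_self[of w j] by simp
    then have "\<bar>A (upd w j (v $ j)) - A w\<bar> \<le> \<bar>v $ j - u $ j\<bar>"
      using ge[OF w(1), of "u $ j" "v $ j" j] le[OF w(1), of "u $ j" "v $ j" j]
        ge[OF w(1), of "v $ j" "u $ j" j] le[OF w(1), of "v $ j" "u $ j" j] b
      by (cases "u $ j \<le> v $ j") auto
    moreover have "(\<Sum>j\<in>insert j J. \<bar>v $ j - u $ j\<bar>) = \<bar>v $ j - u $ j\<bar> + (\<Sum>j\<in>J. \<bar>v $ j - u $ j\<bar>)"
      using w(2) by (simp add: finite_subset[OF subset_UNIV])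
    ultimately show "\<bar>A (upd w j (v $ j)) - A u\<bar> \<le> (\<Sum>j\<in>insert j J. \<bar>v $ j - u $ j\<bar>)"
      using w(4) by linarith
  qed simp
  ultimately show ?thesis
    using mar unfolding quasi_copula_def upd_one by auto
qed

section \<open>Interpolation of a quasi-copula on a grid\<close>

lemma ramp_bounds: "0 \<le> ramp m i t" "ramp m i t \<le> 1"
  by (auto simp: ramp_def)

lemma ramp_mono: "s \<le> t \<Longrightarrow> ramp m i s \<le> ramp m i t"
  using mult_left_mono[of s t "real m"] by (auto simp: ramp_def)

lemma ramp_Suc_le: "ramp m (Suc i) t \<le> ramp m i t"
  by (auto simp: ramp_def)

lemma ramp_at_0 [simp]: "ramp m i 0 = 0"
  by (simp add: ramp_def)

lemma ramp_at_1: "i < m \<Longrightarrow> ramp m i 1 = 1"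
  by (simp add: ramp_def)

lemma ramp_top: "t \<le> 1 \<Longrightarrow> ramp m m t = 0"
  using mult_left_le[of t "real m"] by (auto simp: ramp_def)

lemma sum_ramp: "0 \<le> t \<Longrightarrow> t \<le> 1 \<Longrightarrow> (\<Sum>i<m. ramp m i t) = real m * t"
proof -
  assume t: "0 \<le> t" "t \<le> 1"
  have "(\<Sum>i<n. ramp m i t) = min (real n) (real m * t)" for n
    using t by (induction n) (auto simp: ramp_def)
  moreover have "real m * t \<le> real m" using t by (simp add: mult_left_le)
  ultimately show ?thesis by simp
qed

text \<open>
  For \<open>f = (\<lambda>t. t)\<close> these are the piecewise linear hat functions centred at the grid points \<open>g / m\<close>;
  a general \<open>f\<close> reshapes the passage from one grid point to the next.
\<close>

definition hat :: "nat \<Rightarrow> (real \<Rightarrow> real) \<Rightarrow> nat \<Rightarrow> real \<Rightarrow> real" where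
  "hat m f g t = (if g = 0 then 1 else f (ramp m (g - 1) t)) - f (ramp m g t)"

definition grid_point :: "nat \<Rightarrow> ('n \<Rightarrow> nat) \<Rightarrow> real ^ 'n" where
  "grid_point m g = (\<chi> k. real (g k) / real m)"

definition interp :: "nat \<Rightarrow> (real \<Rightarrow> real) \<Rightarrow> (real ^ 'n \<Rightarrow> real) \<Rightarrow> real ^ 'n \<Rightarrow> real" where
  "interp m f Q x =
     (\<Sum>g\<in>UNIV \<rightarrow>\<^sub>E {..m}. Q (grid_point m g) * (\<Prod>k\<in>UNIV. hat m f (g k) (x $ k)))"

text \<open>
  The common one-dimensional margin of all functions \<open>interp m f Q\<close>.
\<close>

definition grid_margin :: "nat \<Rightarrow> (real \<Rightarrow> real) \<Rightarrow> real \<Rightarrow> real" where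
  "grid_margin m f t = (\<Sum>i<m. f (ramp m i t)) / real m"

lemma sum_PiE_split:
  "(\<Sum>g\<in>UNIV \<rightarrow>\<^sub>E S. F g) = (\<Sum>g\<in>(-{k}) \<rightarrow>\<^sub>E S. \<Sum>j\<in>S. F (g(k := j)) :: real)"
  for k :: "'n::finite"
proof -
  have "(UNIV :: 'n set) = insert k (-{k})" by auto
  then have "(\<Sum>g\<in>UNIV \<rightarrow>\<^sub>E S. F g) = (\<Sum>g\<in>insert k (-{k}) \<rightarrow>\<^sub>E S. F g)" by simp
  also have "\<dots> = (\<Sum>(j, g)\<in>S \<times> ((-{k}) \<rightarrow>\<^sub>E S). F (g(k := j)))"
    unfolding PiE_insert_eq by (subst sum.reindex[OF inj_combinator]) (auto intro!: sum.cong)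
  also have "\<dots> = (\<Sum>j\<in>S. \<Sum>g\<in>(-{k}) \<rightarrow>\<^sub>E S. F (g(k := j)))"
    by (rule sum.cartesian_product[symmetric])
  finally show ?thesis by (subst sum.swap)
qed

text \<open>
  Summation by parts turns weights on grid values into weights on the increments between neighbouring
  grid points, and quasi-copulas are controlled through such increments.
\<close>

lemma abel_hat:
  fixes q \<phi> :: "nat \<Rightarrow> real"
  shows "(\<Sum>j\<le>n. q j * ((if j = 0 then 1 else \<phi> (j - 1)) - \<phi> j)) = q 0 + (\<Sum>j<n. (q (Suc j) - q j) * \<phi> j) - q n * \<phi> n"
  by (induction n) (auto simp: algebra_simps)

text \<open>
  The assumptions on \<open>f\<close> make the functions \<open>hat m f g\<close> a nonnegative partition of unity on \<open>[0, 1]\<close>.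
\<close>

locale profile =
  fixes m :: nat and f :: "real \<Rightarrow> real"
  assumes m_pos: "0 < m" and f_0 [simp]: "f 0 = 0" and f_1 [simp]: "f 1 = 1"
    and f_mono: "0 \<le> s \<Longrightarrow> s \<le> t \<Longrightarrow> t \<le> 1 \<Longrightarrow> f s \<le> f t"
begin

lemma f_ramp_bounds: "0 \<le> f (ramp m i t)" "f (ramp m i t) \<le> 1"
  using f_mono[of 0 "ramp m i t"] f_mono[of "ramp m i t" 1] by (auto simp: ramp_bounds)

lemma f_ramp_mono: "s \<le> t \<Longrightarrow> f (ramp m i s) \<le> f (ramp m i t)"
  by (intro f_mono ramp_bounds ramp_mono)

lemma hat_nonneg: "0 \<le> hat m f g t"
  using ramp_Suc_le[of m "g - 1" t]
  by (auto simp: hat_def f_ramp_bounds intro!: f_mono ramp_bounds)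

lemma sum_hat: "t \<le> 1 \<Longrightarrow> (\<Sum>g\<le>m. hat m f g t) = 1"
  using abel_hat[of "\<lambda>_. 1" "\<lambda>j. f (ramp m j t)" m] by (simp add: hat_def ramp_top)

lemma hat_nonzeroD:
  assumes "hat m f g t \<noteq> 0" "0 \<le> t"
  shows "\<bar>real g / real m - t\<bar> \<le> 1 / real m"
proof -
  have "ramp m g t < 1"
  proof (rule ccontr)
    assume "\<not> ramp m g t < 1"
    then have "ramp m g t = 1" using ramp_bounds(2)[of m g t] by simp
    moreover from this have "ramp m (g - 1) t = 1"
      using ramp_Suc_le[of m "g - 1" t] ramp_bounds(2)[of m "g - 1" t] by (cases g) auto
    ultimately show False using assms(1) by (auto simp: hat_def split: if_splits)
  qed
  then have 1: "real m * t \<le> real g + 1" by (auto simp: ramp_def)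
  have 2: "real g - 1 \<le> real m * t"
  proof (cases g)
    case (Suc j)
    have "ramp m j t > 0"
    proof (rule ccontr)
      assume "\<not> ramp m j t > 0"
      then have "ramp m j t = 0" using ramp_bounds(1)[of m j t] by simp
      moreover from this have "ramp m g t = 0"
        using ramp_Suc_le[of m j t] ramp_bounds(1)[of m g t] Suc by auto
      ultimately show False using assms(1) Suc by (auto simp: hat_def)
    qed
    then show ?thesis using Suc by (auto simp: ramp_def)
  next
    case 0
    have "0 \<le> real m * t" using assms by simp
    then show ?thesis using 0 by simp
  qed
  have "real m > 0" using m_pos by simp
  then have "real g / real m - t = (real g - real m * t) / real m" by (simp add: field_simps)
  then have "\<bar>real g / real m - t\<bar> = \<bar>real g - real m * t\<bar> / real m" by simp
  then show ?thesis using 1 2 \<open>real m > 0\<close> by (simp add: divide_right_mono)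
qed

lemma grid_margin_0 [simp]: "grid_margin m f 0 = 0"
  by (simp add: grid_margin_def)

lemma grid_margin_1 [simp]: "grid_margin m f 1 = 1"
  using m_pos by (simp add: grid_margin_def ramp_at_1)

lemma grid_margin_mono: "s \<le> t \<Longrightarrow> grid_margin m f s \<le> grid_margin m f t"
  by (auto simp: grid_margin_def intro!: divide_right_mono sum_mono f_ramp_mono)

lemma grid_margin_lipschitz:
  assumes "\<And>s t. 0 \<le> s \<Longrightarrow> s \<le> t \<Longrightarrow> t \<le> 1 \<Longrightarrow> f t - f s \<le> C * (t - s)"
    and "0 \<le> s" "s \<le> t" "t \<le> 1"
  shows "grid_margin m f t - grid_margin m f s \<le> C * (t - s)"
proof -
  have "(\<Sum>i<m. f (ramp m i t)) - (\<Sum>i<m. f (ramp m i s)) \<le> (\<Sum>i<m. C * (ramp m i t - ramp m i s))"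
    unfolding sum_subtractf[symmetric] using assms by (intro sum_mono assms(1) ramp_bounds ramp_mono)
  also have "\<dots> = real m * (C * (t - s))"
    using assms by (simp add: sum_distrib_left[symmetric] sum_subtractf sum_ramp algebra_simps)
  finally show ?thesis
    using m_pos by (simp add: grid_margin_def diff_divide_distrib[symmetric] divide_le_eq mult.commute)
qed

lemma grid_point_cube: "g \<in> UNIV \<rightarrow>\<^sub>E {..m} \<Longrightarrow> grid_point m g \<in> cbox 0 1"
  using m_pos by (auto simp: grid_point_def mem_box_cart PiE_iff)

lemma grid_point_step:
  assumes "g \<in> (-{k}) \<rightarrow>\<^sub>E {..m}" "j < m" "quasi_copula Q"
  shows "0 \<le> Q (grid_point m (g(k := Suc j))) - Q (grid_point m (g(k := j)))"
    and "Q (grid_point m (g(k := Suc j))) - Q (grid_point m (g(k := j))) \<le> 1 / real m"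
proof -
  let ?x = "grid_point m (g(k := 0))"
  have eq: "grid_point m (g(k := i)) = upd ?x k (real i / real m)" for i
    by (auto simp: grid_point_def vec_eq_iff)
  have x: "?x \<in> cbox 0 1"
    using assms(1) by (intro grid_point_cube) (auto simp: PiE_iff)
  have b: "0 \<le> real j / real m" "real j / real m \<le> real (Suc j) / real m" "real (Suc j) / real m \<le> 1"
    using assms(2) by (auto simp: divide_right_mono)
  show "0 \<le> Q (grid_point m (g(k := Suc j))) - Q (grid_point m (g(k := j)))"
    using quasi_copula_incr_nonneg[OF assms(3) x b, of k] unfolding eq[of j] eq[of "Suc j"] by linarith
  have "Q (grid_point m (g(k := Suc j))) - Q (grid_point m (g(k := j))) \<le> real (Suc j) / real m - real j / real m"
    using quasi_copula_incr_le[OF assms(3) x b, of k] unfolding eq[of j] eq[of "Suc j"] .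
  then show "Q (grid_point m (g(k := Suc j))) - Q (grid_point m (g(k := j))) \<le> 1 / real m"
    by (simp add: diff_divide_distrib[symmetric])
qed

lemma interp_upd:
  fixes Q :: "real ^ 'n \<Rightarrow> real"
  assumes Q: "quasi_copula Q" and t: "t \<le> 1"
  shows "interp m f Q (upd x k t) =
    (\<Sum>g\<in>(-{k}) \<rightarrow>\<^sub>E {..m}. (\<Prod>l\<in>-{k}. hat m f (g l) (x $ l)) *
       (\<Sum>j<m. (Q (grid_point m (g(k := Suc j))) - Q (grid_point m (g(k := j)))) * f (ramp m j t)))"
  unfolding interp_def sum_PiE_split[where k = k]
proof (rule sum.cong)
  fix g assume g: "g \<in> (-{k}) \<rightarrow>\<^sub>E {..m}"
  let ?W = "\<Prod>l\<in>-{k}. hat m f (g l) (x $ l)"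
  let ?q = "\<lambda>j. Q (grid_point m (g(k := j)))"
  have W: "(\<Prod>l\<in>UNIV. hat m f ((g(k := j)) l) (upd x k t $ l)) = hat m f j t * ?W" for j
  proof -
    have "(\<Prod>l\<in>UNIV. hat m f ((g(k := j)) l) (upd x k t $ l)) =
      hat m f ((g(k := j)) k) (upd x k t $ k) * (\<Prod>l\<in>UNIV - {k}. hat m f ((g(k := j)) l) (upd x k t $ l))"
      by (rule prod.remove) auto
    then show ?thesis by (simp add: Compl_eq_Diff_UNIV)
  qed
  have "?q 0 = 0"
    using g by (intro quasi_copula_grounded[OF Q, of _ k] grid_point_cube) (auto simp: PiE_iff grid_point_def)
  then have eq: "(\<Sum>j\<le>m. ?q j * hat m f j t) = (\<Sum>j<m. (?q (Suc j) - ?q j) * f (ramp m j t))"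
    using abel_hat[of ?q "\<lambda>j. f (ramp m j t)" m] t by (simp add: hat_def ramp_top)
  have "(\<Sum>j\<in>{..m}. ?q j * (\<Prod>l\<in>UNIV. hat m f ((g(k := j)) l) (upd x k t $ l))) = ?W * (\<Sum>j\<le>m. ?q j * hat m f j t)"
    unfolding W sum_distrib_left by (rule sum.cong) (simp_all only: mult_ac)
  then show "(\<Sum>j\<in>{..m}. ?q j * (\<Prod>l\<in>UNIV. hat m f ((g(k := j)) l) (upd x k t $ l))) =
    ?W * (\<Sum>j<m. (?q (Suc j) - ?q j) * f (ramp m j t))"
    by (simp only: eq)
qed simp

text \<open>
  Along one axis the interpolation of grid data is a combination of the nondecreasing functions
  \<open>f \<circ> ramp m j\<close> whose coefficients are increments of \<open>Q\<close> over one grid step, hence lie between \<open>0\<close> and \<open>1 / m\<close>;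
  along the other axes it is an average.
\<close>

lemma interp_incr:
  fixes Q :: "real ^ 'n \<Rightarrow> real"
  assumes Q: "quasi_copula Q" and x: "x \<in> cbox 0 1" and st: "s \<le> t" "t \<le> 1"
  shows "0 \<le> interp m f Q (upd x k t) - interp m f Q (upd x k s)"
    and "interp m f Q (upd x k t) - interp m f Q (upd x k s) \<le> grid_margin m f t - grid_margin m f s"
proof -
  let ?G = "(-{k}) \<rightarrow>\<^sub>E {..m}"
  let ?W = "\<lambda>g. \<Prod>l\<in>-{k}. hat m f (g l) (x $ l)"
  let ?d = "\<lambda>g j. Q (grid_point m (g(k := Suc j))) - Q (grid_point m (g(k := j)))"
  let ?D = "\<lambda>g. \<Sum>j<m. ?d g j * (f (ramp m j t) - f (ramp m j s))"
  have eq: "interp m f Q (upd x k t) - interp m f Q (upd x k s) = (\<Sum>g\<in>?G. ?W g * ?D g)"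
    using st by (simp add: interp_upd[OF Q] sum_subtractf right_diff_distrib)
  have W: "0 \<le> ?W g" for g by (intro prod_nonneg ballI hat_nonneg)
  have f: "0 \<le> f (ramp m j t) - f (ramp m j s)" for j using f_ramp_mono st by simp
  have "(\<Sum>g\<in>?G. ?W g) = (\<Prod>l\<in>-{k}. \<Sum>j\<le>m. hat m f j (x $ l))"
    by (subst prod_sum_PiE) auto
  also have "\<dots> = 1" using x by (intro prod.neutral) (auto simp: sum_hat mem_box_cart)
  finally have W1: "(\<Sum>g\<in>?G. ?W g) = 1" .
  have D: "0 \<le> ?D g" "?D g \<le> grid_margin m f t - grid_margin m f s" if g: "g \<in> ?G" for g
  proof -
    show "0 \<le> ?D g"
      using grid_point_step(1)[OF g _ Q] f by (intro sum_nonneg mult_nonneg_nonneg) auto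
    have "?D g \<le> (\<Sum>j<m. 1 / real m * (f (ramp m j t) - f (ramp m j s)))"
      using grid_point_step(2)[OF g _ Q] f by (intro sum_mono mult_right_mono) auto
    also have "\<dots> = grid_margin m f t - grid_margin m f s"
      unfolding grid_margin_def sum_distrib_left[symmetric] sum_subtractf by (simp add: diff_divide_distrib)
    finally show "?D g \<le> grid_margin m f t - grid_margin m f s" .
  qed
  show "0 \<le> interp m f Q (upd x k t) - interp m f Q (upd x k s)"
    unfolding eq
  proof (rule sum_nonneg)
    show "0 \<le> ?W g * ?D g" if "g \<in> ?G" for g
      using D(1)[OF that] W[of g] by (rule mult_nonneg_nonneg[rotated])
  qed
  have "(\<Sum>g\<in>?G. ?W g * ?D g) \<le> (\<Sum>g\<in>?G. ?W g * (grid_margin m f t - grid_margin m f s))"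
  proof (rule sum_mono)
    show "?W g * ?D g \<le> ?W g * (grid_margin m f t - grid_margin m f s)" if "g \<in> ?G" for g
      using D(2)[OF that] W[of g] by (rule mult_left_mono)
  qed
  also have "\<dots> = (\<Sum>g\<in>?G. ?W g) * (grid_margin m f t - grid_margin m f s)"
    by (rule sum_distrib_right[symmetric])
  finally show "interp m f Q (upd x k t) - interp m f Q (upd x k s) \<le> grid_margin m f t - grid_margin m f s"
    by (simp only: eq W1 mult_1)
qed

lemma interp_grounded:
  assumes "quasi_copula Q" "x $ k = 0"
  shows "interp m f Q x = 0"
proof -
  have "upd x k 0 = x" using assms(2) by (auto simp: vec_eq_iff)
  then show ?thesis using interp_upd[OF assms(1), of 0 x k] by simp
qed

lemma interp_close:
  fixes Q :: "real ^ 'n \<Rightarrow> real"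
  assumes Q: "quasi_copula Q" and x: "x \<in> cbox 0 1"
  shows "\<bar>interp m f Q x - Q x\<bar> \<le> real CARD('n) / real m"
proof -
  let ?G = "UNIV \<rightarrow>\<^sub>E {..m} :: ('n \<Rightarrow> nat) set"
  let ?W = "\<lambda>g. \<Prod>l\<in>UNIV. hat m f (g l) (x $ l)"
  have W: "0 \<le> ?W g" for g by (intro prod_nonneg ballI hat_nonneg)
  have "(\<Sum>g\<in>?G. ?W g) = (\<Prod>l\<in>UNIV. \<Sum>j\<le>m. hat m f j (x $ l))"
    by (subst prod_sum_PiE) auto
  also have "\<dots> = 1" using x by (intro prod.neutral) (auto simp: sum_hat mem_box_cart)
  finally have W1: "(\<Sum>g\<in>?G. ?W g) = 1" .
  have "interp m f Q x - Q x = (\<Sum>g\<in>?G. Q (grid_point m g) * ?W g) - Q x * (\<Sum>g\<in>?G. ?W g)"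
    by (simp add: interp_def W1)
  also have "\<dots> = (\<Sum>g\<in>?G. (Q (grid_point m g) - Q x) * ?W g)"
    by (simp add: sum_distrib_left sum_subtractf left_diff_distrib)
  finally have "\<bar>interp m f Q x - Q x\<bar> \<le> (\<Sum>g\<in>?G. \<bar>(Q (grid_point m g) - Q x) * ?W g\<bar>)"
    by (simp add: sum_abs)
  also have "\<dots> \<le> (\<Sum>g\<in>?G. real CARD('n) / real m * ?W g)"
  proof (rule sum_mono)
    fix g assume g: "g \<in> ?G"
    show "\<bar>(Q (grid_point m g) - Q x) * ?W g\<bar> \<le> real CARD('n) / real m * ?W g"
    proof (cases "?W g = 0")
      case True
      show ?thesis unfolding True by simp
    next
      case False
      then have "\<bar>real (g l) / real m - x $ l\<bar> \<le> 1 / real m" for l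
        using x by (intro hat_nonzeroD) (auto simp: mem_box_cart)
      then have "(\<Sum>l\<in>UNIV. \<bar>grid_point m g $ l - x $ l\<bar>) \<le> (\<Sum>l\<in>(UNIV::'n set). 1 / real m)"
        by (intro sum_mono) (simp add: grid_point_def)
      then have "\<bar>Q (grid_point m g) - Q x\<bar> \<le> real CARD('n) / real m"
        using quasi_copula_lipschitz[OF Q x grid_point_cube[OF g]] by simp
      then show ?thesis using mult_right_mono[OF _ W[of g]] W[of g] by (simp only: abs_mult abs_of_nonneg)
    qed
  qed
  finally show ?thesis by (simp only: sum_distrib_left[symmetric] W1)
qed

lemma interp_at_1:
  fixes Q :: "real ^ 'n \<Rightarrow> real"
  assumes Q: "quasi_copula Q"
  shows "interp m f Q 1 = 1"
proof -
  have h: "hat m f g 1 = (if g = m then 1 else 0)" if "g \<le> m" for g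
    using that m_pos by (auto simp: hat_def ramp_at_1 ramp_top)
  have "interp m f Q 1 = (\<Sum>g\<in>UNIV \<rightarrow>\<^sub>E {..m}. if g = (\<lambda>_. m) then Q (grid_point m g) else 0)"
    unfolding interp_def
  proof (rule sum.cong)
    fix g :: "'n \<Rightarrow> nat" assume g: "g \<in> UNIV \<rightarrow>\<^sub>E {..m}"
    show "Q (grid_point m g) * (\<Prod>k\<in>UNIV. hat m f (g k) (1 $ k)) = (if g = (\<lambda>_. m) then Q (grid_point m g) else 0)"
    proof (cases "g = (\<lambda>_. m)")
      case False
      then obtain k where "g k \<noteq> m" by auto
      then have "(\<Prod>k\<in>UNIV. hat m f (g k) (1 $ k)) = 0"
        using g h by (intro prod_zero) (auto simp: PiE_iff intro!: exI[of _ k])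
      then show ?thesis using False by simp
    qed (simp add: h)
  qed simp
  also have "\<dots> = Q (grid_point m (\<lambda>_. m))"
    by (simp add: finite_PiE PiE_iff)
  also have "grid_point m (\<lambda>_. m) = upd 1 k 1" for k :: 'n
    using m_pos by (simp add: grid_point_def vec_eq_iff)
  finally show ?thesis using quasi_copula_margin[OF Q, of 1] by simp
qed

text \<open>
  On the edge the increments of \<open>interp m f Q\<close> are at most those of \<open>grid_margin m f\<close>, and both functions
  rise from 0 to 1, so they coincide.
\<close>

lemma interp_margin:
  fixes Q :: "real ^ 'n \<Rightarrow> real"
  assumes Q: "quasi_copula Q" and t: "0 \<le> t" "t \<le> 1"
  shows "interp m f Q (upd 1 k t) = grid_margin m f t"
proof -
  have "upd 1 k 1 = (1 :: real ^ 'n)" by (simp add: vec_eq_iff)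
  then have "interp m f Q (upd 1 k 1) = 1"
    using interp_at_1[OF Q] by simp
  moreover have "interp m f Q (upd 1 k 0) = 0"
    by (rule interp_grounded[OF Q, of _ k]) simp
  ultimately show ?thesis
    using interp_incr(2)[OF Q one_cube t, of k] interp_incr(2)[OF Q one_cube, of t 1 k] t
      grid_margin_0 grid_margin_1 by linarith
qed

end

lemma quasi_copula_interp:
  fixes Q :: "real ^ 'n \<Rightarrow> real"
  assumes "quasi_copula Q" "0 < m"
  shows "quasi_copula (interp m (\<lambda>t. t) Q)"
proof -
  have id: "profile m (\<lambda>t. t)" using assms(2) by (simp add: profile_def)
  have st: "grid_margin m (\<lambda>t. t) t = t" if "0 \<le> t" "t \<le> 1" for t
    using sum_ramp[OF that, of m] assms(2) by (simp add: grid_margin_def)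
  show ?thesis
  proof (rule quasi_copulaI)
    show "interp m (\<lambda>t. t) Q (upd 1 k t) = t" if "0 \<le> t" "t \<le> 1" for k t
      using profile.interp_margin[OF id assms(1) that] st[OF that] by simp
    show "interp m (\<lambda>t. t) Q x = 0" if "x $ k = 0" for x :: "real ^ 'n" and k
      using profile.interp_grounded[OF id assms(1) that] .
    fix x :: "real ^ 'n" and k and s t :: real assume x: "x \<in> cbox 0 1" and h: "0 \<le> s" "s \<le> t" "t \<le> 1"
    show "0 \<le> interp m (\<lambda>t. t) Q (upd x k t) - interp m (\<lambda>t. t) Q (upd x k s)"
      using profile.interp_incr(1)[OF id assms(1) x h(2,3)] .
    show "interp m (\<lambda>t. t) Q (upd x k t) - interp m (\<lambda>t. t) Q (upd x k s) \<le> t - s"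
      using profile.interp_incr(2)[OF id assms(1) x h(2,3)] st[of s] st[of t] h by simp
  qed
qed

section \<open>Spreading small copies of a quasi-copula over a core of cells\<close>

text \<open>
  The distribution function of the uniform distribution on the intervals with index in \<open>S\<close>.
\<close>

definition avg_ramp :: "nat \<Rightarrow> nat set \<Rightarrow> real \<Rightarrow> real" where
  "avg_ramp m S t = (\<Sum>i\<in>S. ramp m i t) / real (card S)"

text \<open>
  The measure of \<open>spread m S B\<close> puts a scaled copy of the measure of \<open>B\<close>, with mass
  \<open>1 / card S ^ CARD('n)\<close>, on every coarse cell whose indices all lie in \<open>S\<close>.
\<close>

definition spread :: "nat \<Rightarrow> nat set \<Rightarrow> (real ^ 'n \<Rightarrow> real) \<Rightarrow> real ^ 'n \<Rightarrow> real" where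
  "spread m S B x =
     (\<Sum>i\<in>UNIV \<rightarrow>\<^sub>E S. B (\<chi> k. ramp m (i k) (x $ k))) / real (card S) ^ CARD('n)"

text \<open>
  The subtracted product is \<open>spread\<close> of the product copula, so only the deviation of \<open>B\<close> from that
  copula is left in each cell.
\<close>

definition spread_defect :: "nat \<Rightarrow> nat set \<Rightarrow> (real ^ 'n \<Rightarrow> real) \<Rightarrow> real ^ 'n \<Rightarrow> real" where
  "spread_defect m S B x = spread m S B x - (\<Prod>k\<in>UNIV. avg_ramp m S (x $ k))"

text \<open>
  A quasi-copula and the product copula have the same increments in coordinate \<open>k\<close> when some other
  coordinate is 0 or when all others are 1.  Otherwise some other coordinate lies strictly between 0 and
  1, the sum on the right is at least 1, and both increments lie in \<open>[0, t - s]\<close>.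
\<close>

lemma quasi_copula_incr_vs_product:
  fixes B :: "real ^ 'n \<Rightarrow> real" and k :: 'n
  assumes B: "quasi_copula B" and y: "y \<in> cbox 0 1" and st: "0 \<le> s" "s \<le> t" "t \<le> 1"
  defines "\<beta> \<equiv> B (upd y k t) - B (upd y k s) - (t - s) * (\<Prod>l\<in>-{k}. y $ l)"
  shows "(\<exists>l\<in>-{k}. y $ l = 0) \<or> (\<forall>l\<in>-{k}. y $ l = 1) \<Longrightarrow> \<beta> = 0"
    and "\<bar>\<beta>\<bar> \<le> (t - s) * (\<Sum>l\<in>-{k}. of_bool (0 < y $ l \<and> y $ l < 1))"
proof -
  have y01: "0 \<le> y $ l" "y $ l \<le> 1" for l using y by (auto simp: mem_box_cart)
  show zero: "\<beta> = 0" if "(\<exists>l\<in>-{k}. y $ l = 0) \<or> (\<forall>l\<in>-{k}. y $ l = 1)"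
    using that
  proof
    assume "\<exists>l\<in>-{k}. y $ l = 0"
    then obtain l where l: "l \<noteq> k" "y $ l = 0" by auto
    then have "(\<Prod>l\<in>-{k}. y $ l) = 0" by (intro prod_zero) auto
    moreover have "B (upd y k v) = 0" if "0 \<le> v" "v \<le> 1" for v
      using l that by (intro quasi_copula_grounded[OF B, of "upd y k v" l] upd_cube y) auto
    ultimately show ?thesis using st by (simp add: \<beta>_def)
  next
    assume one: "\<forall>l\<in>-{k}. y $ l = 1"
    then have "upd y k v = upd 1 k v" for v by (auto simp: vec_eq_iff)
    moreover have "(\<Prod>l\<in>-{k}. y $ l) = 1" using one by (intro prod.neutral) auto
    ultimately show ?thesis using st by (simp add: \<beta>_def quasi_copula_margin[OF B])
  qed
  show "\<bar>\<beta>\<bar> \<le> (t - s) * (\<Sum>l\<in>-{k}. of_bool (0 < y $ l \<and> y $ l < 1))" (is "_ \<le> _ * ?n")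
  proof (cases "(\<exists>l\<in>-{k}. y $ l = 0) \<or> (\<forall>l\<in>-{k}. y $ l = 1)")
    case True
    have "0 \<le> ?n" by (intro sum_nonneg) auto
    then show ?thesis using zero[OF True] st by simp
  next
    case False
    then obtain l where l: "l \<in> -{k}" "y $ l \<noteq> 1" "y $ l \<noteq> 0" by blast
    then have "of_bool (0 < y $ l \<and> y $ l < 1) = (1::real)" using y01[of l] by auto
    moreover have "of_bool (0 < y $ l \<and> y $ l < 1) \<le> ?n"
      using l(1) by (intro member_le_sum) auto
    ultimately have n: "1 \<le> ?n" by linarith
    have "0 \<le> (\<Prod>l\<in>-{k}. y $ l)" "(\<Prod>l\<in>-{k}. y $ l) \<le> 1"
      using y01 by (auto intro: prod_nonneg prod_le_1)
    then have "0 \<le> (t - s) * (\<Prod>l\<in>-{k}. y $ l)" "(t - s) * (\<Prod>l\<in>-{k}. y $ l) \<le> t - s"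
      using st by (auto simp: mult_left_le)
    then have "\<bar>\<beta>\<bar> \<le> t - s"
      using quasi_copula_incr_nonneg[OF B y st, of k] quasi_copula_incr_le[OF B y st, of k]
      unfolding \<beta>_def by linarith
    also have "\<dots> \<le> (t - s) * ?n" using n st mult_left_mono[of 1 ?n "t - s"] by simp
    finally show ?thesis .
  qed
qed

lemma sum_PiE_prod:
  fixes F :: "'n::finite \<Rightarrow> nat \<Rightarrow> real"
  assumes "finite S"
  shows "(\<Sum>i\<in>UNIV \<rightarrow>\<^sub>E S. \<Prod>k\<in>UNIV. F k (i k)) = (\<Prod>k\<in>UNIV. \<Sum>j\<in>S. F k j)"
  using assms by (subst prod_sum_PiE) auto

text \<open>
  A point lies in the interior of at most one grid interval.
\<close>

lemma active_ramps_le_one: "finite S \<Longrightarrow> (\<Sum>j\<in>S. of_bool (0 < ramp m j x \<and> ramp m j x < 1)) \<le> (1::real)"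
proof -
  assume S: "finite S"
  let ?J = "{j\<in>S. 0 < ramp m j x \<and> ramp m j x < 1}"
  have "j = j'" if "j \<in> ?J" "j' \<in> ?J" for j j'
  proof -
    have "real j < real m * x" "real m * x < real j + 1" "real j' < real m * x" "real m * x < real j' + 1"
      using that by (auto simp: ramp_def)
    then show ?thesis by linarith
  qed
  then have "card ?J \<le> 1" using S by (simp add: card_le_Suc0_iff_eq)
  moreover have "(\<Sum>j\<in>S. of_bool (0 < ramp m j x \<and> ramp m j x < 1)) = real (card ?J)"
    using S by (simp add: sum.If_cases of_bool_def Int_def)
  ultimately show ?thesis by simp
qed

locale core =
  fixes m :: nat and S :: "nat set"
  assumes S_sub: "S \<subseteq> {..<m}" and S_ne: "S \<noteq> {}"
begin

lemma finite_S: "finite S"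
  using S_sub finite_subset by blast

lemma card_S_pos: "0 < card S"
  using S_ne finite_S by (simp add: card_gt_0_iff)

lemma card_S_le: "card S \<le> m"
  using card_mono[OF _ S_sub] by simp

lemma avg_ramp_0 [simp]: "avg_ramp m S 0 = 0"
  by (simp add: avg_ramp_def)

lemma avg_ramp_1 [simp]: "avg_ramp m S 1 = 1"
proof -
  have "(\<Sum>i\<in>S. ramp m i 1) = (\<Sum>i\<in>S. 1)"
    using S_sub by (intro sum.cong ramp_at_1) auto
  then show ?thesis using card_S_pos by (simp add: avg_ramp_def)
qed

lemma avg_ramp_mono: "s \<le> t \<Longrightarrow> avg_ramp m S s \<le> avg_ramp m S t"
  by (auto simp: avg_ramp_def intro!: divide_right_mono sum_mono ramp_mono)

lemma avg_ramp_lipschitz: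
  assumes "0 \<le> s" "s \<le> t" "t \<le> 1"
  shows "avg_ramp m S t - avg_ramp m S s \<le> real m / real (card S) * (t - s)"
proof -
  have "(\<Sum>i\<in>S. ramp m i t) - (\<Sum>i\<in>S. ramp m i s) = (\<Sum>i\<in>S. ramp m i t - ramp m i s)"
    by (simp add: sum_subtractf)
  also have "\<dots> \<le> (\<Sum>i<m. ramp m i t - ramp m i s)"
    using S_sub assms by (intro sum_mono2) (auto simp: ramp_mono)
  also have "\<dots> = real m * (t - s)"
    using assms by (simp add: sum_subtractf sum_ramp right_diff_distrib)
  finally have "((\<Sum>i\<in>S. ramp m i t) - (\<Sum>i\<in>S. ramp m i s)) / real (card S) \<le> real m * (t - s) / real (card S)"
    by (intro divide_right_mono) auto
  then show ?thesis by (simp add: avg_ramp_def diff_divide_distrib)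
qed

lemma profile_avg_ramp: "profile m (avg_ramp m S)"
  using card_S_pos card_S_le by unfold_locales (auto intro: avg_ramp_mono)

lemma prod_avg_ramp:
  fixes x :: "real ^ 'n"
  shows "(\<Prod>k\<in>UNIV. avg_ramp m S (x $ k)) =
    (\<Sum>i\<in>UNIV \<rightarrow>\<^sub>E S. \<Prod>k\<in>UNIV. ramp m (i k) (x $ k)) / real (card S) ^ CARD('n)"
  unfolding avg_ramp_def prod_dividef sum_PiE_prod[OF finite_S, of "\<lambda>k j. ramp m j (x $ k)"] by simp

lemma spread_defect_eq:
  fixes x :: "real ^ 'n"
  shows "spread_defect m S B x = (\<Sum>i\<in>UNIV \<rightarrow>\<^sub>E S.
    B (\<chi> k. ramp m (i k) (x $ k)) - (\<Prod>k\<in>UNIV. ramp m (i k) (x $ k))) / real (card S) ^ CARD('n)"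
  unfolding spread_defect_def spread_def prod_avg_ramp by (simp add: sum_subtractf diff_divide_distrib)

lemma spread_defect_grounded:
  fixes x :: "real ^ 'n"
  assumes B: "quasi_copula B" and k: "x $ k = 0"
  shows "spread_defect m S B x = 0"
proof -
  have "B (\<chi> k. ramp m (i k) (x $ k)) - (\<Prod>k\<in>UNIV. ramp m (i k) (x $ k)) = 0" for i
  proof -
    have "(\<Prod>k\<in>UNIV. ramp m (i k) (x $ k)) = 0"
      using k by (intro prod_zero) (auto intro!: exI[of _ k])
    moreover have "B (\<chi> k. ramp m (i k) (x $ k)) = 0"
      using k by (intro quasi_copula_grounded[OF B, of _ k]) (auto simp: mem_box_cart ramp_bounds)
    ultimately show ?thesis by simp
  qed
  then show ?thesis by (simp add: spread_defect_eq)
qed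

text \<open>
  Each copy contributes at most its share of \<open>avg_ramp m S t - avg_ramp m S s\<close>, and only when the
  point lies in the interior of one of its sides along another axis \<open>l\<close>.  For each \<open>l\<close> this
  selects at most one of the \<open>card S\<close> layers of copies, which yields the factor \<open>1 / card S\<close>.
\<close>

lemma spread_defect_incr:
  fixes x :: "real ^ 'n" and k :: 'n
  assumes B: "quasi_copula B" and st: "0 \<le> s" "s \<le> t" "t \<le> 1"
  defines "\<Delta> \<equiv> spread_defect m S B (upd x k t) - spread_defect m S B (upd x k s)"
  shows "(\<exists>l\<in>-{k}. \<forall>i\<in>S. ramp m i (x $ l) = 0) \<or> (\<forall>l\<in>-{k}. \<forall>i\<in>S. ramp m i (x $ l) = 1) \<Longrightarrow> \<Delta> = 0"
    and "\<bar>\<Delta>\<bar> \<le> (avg_ramp m S t - avg_ramp m S s) * (real CARD('n) / real (card S))"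
proof -
  let ?I = "UNIV \<rightarrow>\<^sub>E S :: ('n \<Rightarrow> nat) set"
  let ?r = "real (card S)"
  let ?y = "\<lambda>i. (\<chi> l. ramp m (i l) (x $ l)) :: real ^ 'n"
  define \<beta> where "\<beta> i = B (upd (?y i) k (ramp m (i k) t)) - B (upd (?y i) k (ramp m (i k) s))
    - (ramp m (i k) t - ramp m (i k) s) * (\<Prod>l\<in>-{k}. ?y i $ l)" for i
  have r: "?r > 0" using card_S_pos by simp
  have y: "?y i \<in> cbox 0 1" for i by (simp add: mem_box_cart ramp_bounds)
  have upd: "(\<chi> l. ramp m (i l) (upd x k v $ l)) = upd (?y i) k (ramp m (i k) v)" for i v
    by (auto simp: vec_eq_iff)
  have prod: "(\<Prod>l\<in>UNIV. ramp m (i l) (upd x k v $ l)) = ramp m (i k) v * (\<Prod>l\<in>-{k}. ?y i $ l)" for i v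
  proof -
    have "(\<Prod>l\<in>UNIV. ramp m (i l) (upd x k v $ l)) =
      ramp m (i k) (upd x k v $ k) * (\<Prod>l\<in>UNIV-{k}. ramp m (i l) (upd x k v $ l))"
      by (rule prod.remove) auto
    then show ?thesis by (simp add: Compl_eq_Diff_UNIV)
  qed
  have \<Delta>: "\<Delta> = (\<Sum>i\<in>?I. \<beta> i) / ?r ^ CARD('n)"
    unfolding \<Delta>_def spread_defect_eq upd prod diff_divide_distrib[symmetric] sum_subtractf[symmetric]
    by (simp add: \<beta>_def algebra_simps)
  have incr: "0 \<le> ramp m i s" "ramp m i s \<le> ramp m i t" "ramp m i t \<le> 1" for i
    using st by (auto simp: ramp_bounds ramp_mono)
  show "\<Delta> = 0"
    if "(\<exists>l\<in>-{k}. \<forall>i\<in>S. ramp m i (x $ l) = 0) \<or> (\<forall>l\<in>-{k}. \<forall>i\<in>S. ramp m i (x $ l) = 1)"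
  proof -
    have "\<beta> i = 0" if i: "i \<in> ?I" for i
      unfolding \<beta>_def
    proof (rule quasi_copula_incr_vs_product(1)[OF B y incr])
      have "i l \<in> S" for l using i by (auto simp: PiE_iff)
      then show "(\<exists>l\<in>-{k}. ?y i $ l = 0) \<or> (\<forall>l\<in>-{k}. ?y i $ l = 1)"
        using \<open>(\<exists>l\<in>-{k}. \<forall>i\<in>S. ramp m i (x $ l) = 0) \<or> _\<close> by auto
    qed
    then show ?thesis by (simp add: \<Delta>)
  qed
  let ?d = "avg_ramp m S t - avg_ramp m S s"
  have d0: "0 \<le> ?d" using avg_ramp_mono st by simp
  \<comment> \<open>The bound for each copy factorises over the axes, so that the sum over all copies becomes a product of sums.\<close>
  define G where "G l q j = (if q = k then ramp m j t - ramp m j s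
    else if q = l then of_bool (0 < ramp m j (x $ l) \<and> ramp m j (x $ l) < 1) else 1)" for l q :: 'n and j
  have G: "(\<Prod>q\<in>UNIV. G l q (i q)) = (ramp m (i k) t - ramp m (i k) s) * of_bool (0 < ?y i $ l \<and> ?y i $ l < 1)"
    if "l \<in> -{k}" for l i
  proof -
    have "(\<Prod>q\<in>UNIV. G l q (i q)) = (\<Prod>q\<in>UNIV. (if q = k then ramp m (i k) t - ramp m (i k) s else 1) *
      (if q = l then of_bool (0 < ramp m (i l) (x $ l) \<and> ramp m (i l) (x $ l) < 1) else 1))"
      using that by (intro prod.cong) (auto simp: G_def)
    then show ?thesis by (simp add: prod.distrib)
  qed
  have Gsum: "(\<Prod>q\<in>UNIV. \<Sum>j\<in>S. G l q j) \<le> ?r ^ CARD('n) * (?d / ?r)" if l: "l \<in> -{k}" for l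
  proof -
    have "(\<Prod>q\<in>UNIV. \<Sum>j\<in>S. G l q j) \<le> (\<Prod>q\<in>UNIV. ?r * (if q = k then ?d else 1) * (if q = l then 1 / ?r else 1))"
    proof (rule prod_mono, intro conjI)
      fix q :: 'n
      show "0 \<le> (\<Sum>j\<in>S. G l q j)"
        using incr by (intro sum_nonneg) (auto simp: G_def)
      have 1: "(\<Sum>j\<in>S. G l q j) = ?r * ?d" if "q = k"
        using that r by (simp add: G_def avg_ramp_def sum_subtractf right_diff_distrib)
      have 2: "(\<Sum>j\<in>S. G l q j) \<le> 1" if "q = l"
        using that l active_ramps_le_one[OF finite_S, of m "x $ l"] by (simp add: G_def)
      have 3: "(\<Sum>j\<in>S. G l q j) = ?r" if "q \<noteq> l" "q \<noteq> k"
        using that by (simp add: G_def)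
      show "(\<Sum>j\<in>S. G l q j) \<le> ?r * (if q = k then ?d else 1) * (if q = l then 1 / ?r else 1)"
        using 1 2 3 l r by auto
    qed
    also have "\<dots> = ?r ^ CARD('n) * (?d / ?r)" by (simp add: prod.distrib)
    finally show ?thesis .
  qed
  have "\<bar>\<Sum>i\<in>?I. \<beta> i\<bar> \<le> (\<Sum>i\<in>?I. \<bar>\<beta> i\<bar>)" by (rule sum_abs)
  also have "\<dots> \<le> (\<Sum>i\<in>?I. (ramp m (i k) t - ramp m (i k) s) * (\<Sum>l\<in>-{k}. of_bool (0 < ?y i $ l \<and> ?y i $ l < 1)))"
    unfolding \<beta>_def by (rule sum_mono) (rule quasi_copula_incr_vs_product(2)[OF B y incr])
  also have "\<dots> = (\<Sum>i\<in>?I. \<Sum>l\<in>-{k}. \<Prod>q\<in>UNIV. G l q (i q))"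
    unfolding sum_distrib_left by (intro sum.cong refl G[symmetric])
  also have "\<dots> = (\<Sum>l\<in>-{k}. \<Prod>q\<in>UNIV. \<Sum>j\<in>S. G l q j)"
    by (subst sum.swap) (simp add: sum_PiE_prod[OF finite_S])
  also have "\<dots> \<le> (\<Sum>l\<in>-{k}. ?r ^ CARD('n) * (?d / ?r))"
    by (rule sum_mono) (rule Gsum)
  also have "\<dots> \<le> (\<Sum>l\<in>(UNIV::'n set). ?r ^ CARD('n) * (?d / ?r))"
    using d0 by (intro sum_mono2) auto
  also have "\<dots> = ?r ^ CARD('n) * (?d * (real CARD('n) / ?r))" by simp
  finally show "\<bar>\<Delta>\<bar> \<le> ?d * (real CARD('n) / ?r)"
    using r by (simp add: \<Delta> abs_div divide_le_eq mult.commute)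
qed

end

section \<open>Combining two quasi-copulas\<close>

text \<open>
  The three summands belong to the arrays \<open>u(i) u(j)\<close>, \<open>(q - u)(i) w(j)\<close> and \<open>w(i) (r - u)(j)\<close>, where \<open>q\<close>
  and \<open>r\<close> are the coarse cell masses of \<open>Q\<close> and \<open>R\<close>.  The two subtracted products, one explicit and one inside
  \<open>spread_defect\<close>, make the margins uniform.
\<close>

definition blend ::
  "nat \<Rightarrow> nat set \<Rightarrow> real \<Rightarrow> (real ^ 'n \<Rightarrow> real) \<Rightarrow> (real ^ 'n \<Rightarrow> real) \<Rightarrow> real ^ 'n \<Rightarrow> real" where
  "blend m S \<theta> Q R x =
     (\<Prod>k\<in>UNIV. x $ k)
     + \<theta> * (interp m (avg_ramp m S) Q x - (\<Prod>k\<in>UNIV. grid_margin m (avg_ramp m S) (x $ k)))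
     + \<theta> * spread_defect m S (interp m (\<lambda>t. t) R) x"

text \<open>
  The hypothesis holds when \<open>u l\<close> is the value at \<open>v l\<close> of a nondecreasing function that joins \<open>(0, 0)\<close> to
  \<open>(1, 1)\<close> with slopes at most \<open>C\<close>; both estimates survive taking products, at the price of a power of \<open>C\<close>.
\<close>

lemma prod_comparison:
  fixes u v :: "'a \<Rightarrow> real"
  assumes "finite I" "1 \<le> C"
    and "\<And>l. l \<in> I \<Longrightarrow> 0 \<le> v l \<and> v l \<le> 1 \<and> 0 \<le> u l \<and> u l \<le> 1 \<and> u l \<le> C * v l \<and> 1 - u l \<le> C * (1 - v l)"
  shows "(\<Prod>l\<in>I. u l) \<le> C ^ card I * (\<Prod>l\<in>I. v l) \<and> 1 - (\<Prod>l\<in>I. u l) \<le> C ^ card I * (1 - (\<Prod>l\<in>I. v l))"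
  using assms(1,3)
proof (induction I rule: finite_induct)
  case (insert a I)
  let ?U = "\<Prod>l\<in>I. u l" and ?V = "\<Prod>l\<in>I. v l" and ?K = "C ^ card I"
  have a: "0 \<le> v a" "v a \<le> 1" "0 \<le> u a" "u a \<le> 1" "u a \<le> C * v a" "1 - u a \<le> C * (1 - v a)"
    using insert.prems[of a] by auto
  have IH: "?U \<le> ?K * ?V" "1 - ?U \<le> ?K * (1 - ?V)" using insert by auto
  have U: "0 \<le> ?U" "?U \<le> 1" "0 \<le> ?V" "?V \<le> 1"
    using insert.prems by (auto intro!: prod_nonneg prod_le_1)
  have K: "1 \<le> ?K" using assms(2) by simp
  have "u a * ?U \<le> (C * v a) * (?K * ?V)"
    using a U IH assms(2) by (intro mult_mono) auto
  moreover have "1 - u a * ?U \<le> C * ?K * (1 - v a * ?V)"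
  proof -
    have "1 - u a * ?U = (1 - u a) + u a * (1 - ?U)" by (simp add: algebra_simps)
    also have "\<dots> \<le> C * (1 - v a) + (C * v a) * (?K * (1 - ?V))"
      using a U IH assms(2) by (intro add_mono mult_mono) auto
    also have "\<dots> \<le> C * (?K * (1 - v a)) + (C * v a) * (?K * (1 - ?V))"
      using a K assms(2) mult_right_mono[OF K, of "1 - v a"] by (intro add_mono mult_left_mono) auto
    also have "\<dots> = C * ?K * (1 - v a * ?V)" by (simp add: algebra_simps)
    finally show ?thesis .
  qed
  ultimately show ?case using insert.hyps by (simp add: mult_ac)
qed simp

text \<open>
  The core keeps the distance \<open>\<delta>\<close> from 0 and 1.  The number \<open>C\<close> bounds the slope of \<open>avg_ramp m S\<close>; the
  factor \<open>\<theta>\<close> compensates it in all dimensions and leaves a reserve \<open>\<eta>\<close>, and the grid is so fine that this reserve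
  dominates the increments of \<open>spread_defect\<close>.
\<close>

locale trimmed_core = core +
  fixes \<delta> \<eta> \<theta> C :: real and d :: nat
  assumes margin: "\<And>i. i \<in> S \<Longrightarrow> \<delta> * real m \<le> real i \<and> real i + 1 \<le> (1 - \<delta>) * real m"
    and \<delta>: "0 \<le> \<delta>" "\<delta> \<le> 1" and \<theta>: "0 \<le> \<theta>" "\<theta> \<le> 1" and \<eta>: "0 \<le> \<eta>"
    and C: "C = real m / real (card S)"
    and damping: "\<theta> * C ^ d \<le> 1 - \<eta>"
    and fine: "C * (real d / real (card S)) \<le> \<eta> * \<delta> ^ d"
    and d: "0 < d"
begin

interpretation profile m "avg_ramp m S"
  by (rule profile_avg_ramp)

abbreviation "h \<equiv> grid_margin m (avg_ramp m S)"

lemma C_ge_1: "1 \<le> C"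
  using card_S_pos card_S_le by (simp add: C le_divide_eq)

lemma h_lipschitz: "0 \<le> s \<Longrightarrow> s \<le> t \<Longrightarrow> t \<le> 1 \<Longrightarrow> h t - h s \<le> C * (t - s)"
  unfolding C by (rule grid_margin_lipschitz[OF avg_ramp_lipschitz])

lemma h_bounds:
  assumes "0 \<le> t" "t \<le> 1"
  shows "0 \<le> t \<and> t \<le> 1 \<and> 0 \<le> h t \<and> h t \<le> 1 \<and> h t \<le> C * t \<and> 1 - h t \<le> C * (1 - t)"
  using assms grid_margin_mono[of 0 t] grid_margin_mono[of t 1] h_lipschitz[of 0 t] h_lipschitz[of t 1] by simp

text \<open>
  Mixing with the product copula makes up for the distortion of the margins by \<open>h\<close>, with a
  reserve proportional to the distance of the product from 0 and from 1.
\<close>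

lemma damped_product:
  fixes x :: "real ^ 'n"
  assumes x: "x \<in> cbox 0 1" and I: "card I \<le> n" and K: "0 \<le> K" "K * C ^ n \<le> 1 - \<eta>"
  shows "K * (\<Prod>l\<in>I. h (x $ l)) \<le> (1 - \<eta>) * (\<Prod>l\<in>I. x $ l)"
    and "K * (1 - (\<Prod>l\<in>I. h (x $ l))) \<le> (1 - \<eta>) * (1 - (\<Prod>l\<in>I. x $ l))"
proof -
  let ?H = "\<Prod>l\<in>I. h (x $ l)" and ?X = "\<Prod>l\<in>I. x $ l"
  have x01: "0 \<le> x $ l" "x $ l \<le> 1" for l using x by (auto simp: mem_box_cart)
  have X: "0 \<le> ?X" "?X \<le> 1" using x01 by (auto intro: prod_nonneg prod_le_1)
  have cmp: "?H \<le> C ^ card I * ?X" "1 - ?H \<le> C ^ card I * (1 - ?X)"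
    using prod_comparison[OF finite_subset[OF subset_UNIV finite_class.finite_UNIV] C_ge_1,
      of I "\<lambda>l. x $ l" "\<lambda>l. h (x $ l)"] h_bounds[OF x01] by auto
  have "K * C ^ card I \<le> K * C ^ n"
    using K C_ge_1 I by (intro mult_left_mono power_increasing) auto
  then have KC: "K * C ^ card I \<le> 1 - \<eta>" using K by linarith
  have "K * ?H \<le> K * C ^ card I * ?X" using mult_left_mono[OF cmp(1) K(1)] by (simp add: mult.assoc)
  also have "\<dots> \<le> (1 - \<eta>) * ?X" using X KC by (intro mult_right_mono) auto
  finally show "K * ?H \<le> (1 - \<eta>) * ?X" .
  have "K * (1 - ?H) \<le> K * C ^ card I * (1 - ?X)" using mult_left_mono[OF cmp(2) K(1)] by (simp add: mult.assoc)
  also have "\<dots> \<le> (1 - \<eta>) * (1 - ?X)" using X KC by (intro mult_right_mono) auto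
  finally show "K * (1 - ?H) \<le> (1 - \<eta>) * (1 - ?X)" .
qed

lemma ramp_trimmed:
  assumes "i \<in> S"
  shows "t \<le> \<delta> \<Longrightarrow> ramp m i t = 0" "1 - \<delta> \<le> t \<Longrightarrow> ramp m i t = 1"
proof -
  show "ramp m i t = 0" if "t \<le> \<delta>"
    using margin[OF assms] mult_left_mono[OF that, of "real m"] by (auto simp: ramp_def mult.commute)
  show "ramp m i t = 1" if "1 - \<delta> \<le> t"
    using margin[OF assms] mult_left_mono[OF that, of "real m"] by (auto simp: ramp_def mult.commute)
qed

text \<open>
  The base part has increments in \<open>[\<eta> V (t - s), (t - s) - \<eta> (1 - V) (t - s)]\<close>, where \<open>V\<close> is the product of the
  other coordinates.  The increment of \<open>spread_defect\<close> vanishes unless all other coordinates exceed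
  \<open>\<delta>\<close> and one of them is below \<open>1 - \<delta>\<close>; then \<open>V\<close> and \<open>1 - V\<close> are at least \<open>\<delta> ^ d\<close>, and the reserve absorbs it.
\<close>

lemma blend_incr:
  fixes x :: "real ^ 'n"
  assumes Q: "quasi_copula Q" and R: "quasi_copula R" and d_eq: "d = CARD('n)"
    and x: "x \<in> cbox 0 1" and st: "0 \<le> s" "s \<le> t" "t \<le> 1"
  shows "0 \<le> blend m S \<theta> Q R (upd x k t) - blend m S \<theta> Q R (upd x k s)"
    and "blend m S \<theta> Q R (upd x k t) - blend m S \<theta> Q R (upd x k s) \<le> t - s"
proof -
  let ?B = "interp m (\<lambda>t. t) R"
  let ?V = "\<Prod>l\<in>-{k}. x $ l" and ?H = "\<Prod>l\<in>-{k}. h (x $ l)"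
  define \<Delta>I where "\<Delta>I = interp m (avg_ramp m S) Q (upd x k t) - interp m (avg_ramp m S) Q (upd x k s)"
  define \<Delta>D where "\<Delta>D = spread_defect m S ?B (upd x k t) - spread_defect m S ?B (upd x k s)"
  have B: "quasi_copula ?B" by (rule quasi_copula_interp[OF R m_pos])
  have x01: "0 \<le> x $ l" "x $ l \<le> 1" for l using x by (auto simp: mem_box_cart)
  have V: "0 \<le> ?V" "?V \<le> 1" using x01 by (auto intro: prod_nonneg prod_le_1)
  have H: "0 \<le> ?H" "?H \<le> 1" using h_bounds[OF x01] by (auto intro: prod_nonneg prod_le_1)
  have eq: "blend m S \<theta> Q R (upd x k t) - blend m S \<theta> Q R (upd x k s) =
    (t - s) * ?V + \<theta> * (\<Delta>I - (h t - h s) * ?H) + \<theta> * \<Delta>D"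
    using prod_upd[of "\<lambda>z. z" x k] prod_upd[of h x k]
    by (simp add: blend_def \<Delta>I_def \<Delta>D_def algebra_simps)
  have \<Delta>I: "0 \<le> \<Delta>I" "\<Delta>I \<le> h t - h s"
    unfolding \<Delta>I_def using interp_incr[OF Q x st(2,3)] by auto
  have \<Delta>h: "0 \<le> h t - h s" "h t - h s \<le> C * (t - s)"
    using grid_margin_mono st h_lipschitz by auto
  have card: "card (-{k}) \<le> d - 1" by (simp add: d_eq Compl_eq_Diff_UNIV)
  have "C * C ^ (d - 1) = C ^ d" using d by (cases d) auto
  then have K: "0 \<le> \<theta> * C" "\<theta> * C * C ^ (d - 1) \<le> 1 - \<eta>"
    using \<theta> C_ge_1 damping by (auto simp: mult.assoc)
  have lower: "\<theta> * ((h t - h s) * ?H) \<le> (t - s) * ((1 - \<eta>) * ?V)"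
  proof -
    have "\<theta> * ((h t - h s) * ?H) \<le> \<theta> * (C * (t - s) * ?H)"
      using \<theta> H \<Delta>h by (intro mult_left_mono mult_right_mono) auto
    also have "\<dots> = (t - s) * (\<theta> * C * ?H)" by (simp add: mult_ac)
    also have "\<dots> \<le> (t - s) * ((1 - \<eta>) * ?V)"
      using st by (intro mult_left_mono damped_product(1)[OF x card K]) auto
    finally show ?thesis .
  qed
  have upper: "\<theta> * ((h t - h s) * (1 - ?H)) \<le> (t - s) * ((1 - \<eta>) * (1 - ?V))"
  proof -
    have "\<theta> * ((h t - h s) * (1 - ?H)) \<le> \<theta> * (C * (t - s) * (1 - ?H))"
      using \<theta> H \<Delta>h by (intro mult_left_mono mult_right_mono) auto
    also have "\<dots> = (t - s) * (\<theta> * C * (1 - ?H))" by (simp add: mult_ac)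
    also have "\<dots> \<le> (t - s) * ((1 - \<eta>) * (1 - ?V))"
      using st by (intro mult_left_mono damped_product(2)[OF x card K]) auto
    finally show ?thesis .
  qed
  have defect: "\<bar>\<theta> * \<Delta>D\<bar> \<le> (t - s) * (\<eta> * ?V)" "\<bar>\<theta> * \<Delta>D\<bar> \<le> (t - s) * (\<eta> * (1 - ?V))"
  proof -
    have "\<bar>\<theta> * \<Delta>D\<bar> \<le> (t - s) * (\<eta> * ?V) \<and> \<bar>\<theta> * \<Delta>D\<bar> \<le> (t - s) * (\<eta> * (1 - ?V))"
    proof (cases "(\<exists>l\<in>-{k}. x $ l \<le> \<delta>) \<or> (\<forall>l\<in>-{k}. 1 - \<delta> \<le> x $ l)")
      case True
      then have "\<Delta>D = 0"
        unfolding \<Delta>D_def using ramp_trimmed by (intro spread_defect_incr(1)[OF B st]) blast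
      then show ?thesis using st \<eta> V by simp
    next
      case False
      have "\<bar>\<theta> * \<Delta>D\<bar> \<le> 1 * \<bar>\<Delta>D\<bar>"
        unfolding abs_mult using \<theta> by (intro mult_right_mono) auto
      also have "\<dots> \<le> (avg_ramp m S t - avg_ramp m S s) * (real d / real (card S))"
        unfolding \<Delta>D_def d_eq using spread_defect_incr(2)[OF B st] by simp
      also have "\<dots> \<le> C * (t - s) * (real d / real (card S))"
        using avg_ramp_lipschitz[OF st] by (intro mult_right_mono) (auto simp: C)
      also have "\<dots> = (t - s) * (C * (real d / real (card S)))" by simp
      also have "\<dots> \<le> (t - s) * (\<eta> * \<delta> ^ d)"
        using st by (intro mult_left_mono fine) auto
      finally have le: "\<bar>\<theta> * \<Delta>D\<bar> \<le> (t - s) * (\<eta> * \<delta> ^ d)" .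
      have "\<delta> ^ d \<le> \<delta> ^ card (-{k})"
        using \<delta> card by (intro power_decreasing) auto
      also have "\<dots> = (\<Prod>l\<in>-{k}. \<delta>)" by simp
      also have "\<dots> \<le> ?V"
      proof -
        have "\<forall>l\<in>-{k}. \<not> x $ l \<le> \<delta>" using False by blast
        then show ?thesis using \<delta> by (intro prod_mono) (auto simp: not_le intro: less_imp_le)
      qed
      finally have 1: "\<delta> ^ d \<le> ?V" .
      obtain l where l: "l \<in> -{k}" "x $ l \<le> 1 - \<delta>" using False by force
      have "?V = x $ l * (\<Prod>l\<in>-{k}-{l}. x $ l)" using l by (intro prod.remove) auto
      also have "\<dots> \<le> x $ l" using x01 by (intro mult_left_le prod_le_1) auto
      finally have "\<delta> \<le> 1 - ?V" using l by simp
      moreover have "\<delta> ^ d \<le> \<delta>" using \<delta> d power_decreasing[of 1 d \<delta>] by simp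
      ultimately have 2: "\<delta> ^ d \<le> 1 - ?V" by simp
      have "(t - s) * (\<eta> * \<delta> ^ d) \<le> (t - s) * (\<eta> * ?V)" "(t - s) * (\<eta> * \<delta> ^ d) \<le> (t - s) * (\<eta> * (1 - ?V))"
        using st \<eta> 1 2 by (auto intro!: mult_left_mono)
      then show ?thesis using le by linarith
    qed
    then show "\<bar>\<theta> * \<Delta>D\<bar> \<le> (t - s) * (\<eta> * ?V)" "\<bar>\<theta> * \<Delta>D\<bar> \<le> (t - s) * (\<eta> * (1 - ?V))" by auto
  qed
  have "0 \<le> \<theta> * \<Delta>I" "\<theta> * \<Delta>I \<le> \<theta> * (h t - h s)"
    using \<theta> \<Delta>I by (auto intro: mult_left_mono)
  then show "0 \<le> blend m S \<theta> Q R (upd x k t) - blend m S \<theta> Q R (upd x k s)"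
    and "blend m S \<theta> Q R (upd x k t) - blend m S \<theta> Q R (upd x k s) \<le> t - s"
    using lower upper defect unfolding eq by (auto simp: algebra_simps abs_le_iff)
qed

lemma quasi_copula_blend:
  fixes Q R :: "real ^ 'n \<Rightarrow> real"
  assumes Q: "quasi_copula Q" and R: "quasi_copula R" and d_eq: "d = CARD('n)"
  shows "quasi_copula (blend m S \<theta> Q R)"
proof (rule quasi_copulaI)
  let ?B = "interp m (\<lambda>t. t) R"
  have B: "quasi_copula ?B" by (rule quasi_copula_interp[OF R m_pos])
  show "blend m S \<theta> Q R (upd 1 k t) = t" if t: "0 \<le> t" "t \<le> 1" for k t
  proof -
    have "spread_defect m S ?B (upd 1 k t) - spread_defect m S ?B (upd 1 k 0) = 0"
      using t S_sub by (intro spread_defect_incr(1)[OF B]) (auto simp: ramp_at_1)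
    moreover have "spread_defect m S ?B (upd 1 k 0) = 0"
      by (rule spread_defect_grounded[OF B, of _ k]) simp
    ultimately have "spread_defect m S ?B (upd 1 k t) = 0" by simp
    then show ?thesis
      using prod_upd[of "\<lambda>z. z" 1 k t] prod_upd[of h 1 k t] interp_margin[OF Q t]
      by (simp add: blend_def)
  qed
  show "blend m S \<theta> Q R x = 0" if "x $ k = 0" for x k
  proof -
    have zero: "(\<Prod>l\<in>UNIV. x $ l) = 0" "(\<Prod>l\<in>UNIV. h (x $ l)) = 0"
      using that by (auto intro!: prod_zero exI[of _ k])
    then show ?thesis
      unfolding blend_def zero interp_grounded[OF Q that] spread_defect_grounded[OF B that] by simp
  qed
qed (use blend_incr[OF assms] in auto)

text \<open>
  The difference splits into four parts: the defect of the damped product, which lies in \<open>[0, 1 - \<theta>]\<close>;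
  the loss \<open>(1 - \<theta>) * Q x\<close>, which lies in the same interval; the interpolation error; and the spread copies.  The
  last two are at most \<open>\<eta>\<close> each.
\<close>

lemma blend_close:
  fixes Q R :: "real ^ 'n \<Rightarrow> real"
  assumes Q: "quasi_copula Q" and R: "quasi_copula R" and d_eq: "d = CARD('n)" and x: "x \<in> cbox 0 1"
  shows "\<bar>Q x - blend m S \<theta> Q R x\<bar> \<le> (1 - \<theta>) + 2 * \<eta>"
proof -
  let ?B = "interp m (\<lambda>t. t) R"
  let ?D = "spread_defect m S ?B"
  let ?I = "interp m (avg_ramp m S) Q x"
  let ?V = "\<Prod>l\<in>UNIV. x $ l" and ?H = "\<Prod>l\<in>UNIV. h (x $ l)"
  have B: "quasi_copula ?B" by (rule quasi_copula_interp[OF R m_pos])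
  have x01: "0 \<le> x $ l" "x $ l \<le> 1" for l using x by (auto simp: mem_box_cart)
  have V: "0 \<le> ?V" "?V \<le> 1" using x01 by (auto intro: prod_nonneg prod_le_1)
  have r: "0 < real (card S)" using card_S_pos by simp
  have "\<theta> * ?H \<le> (1 - \<eta>) * ?V" "\<theta> * (1 - ?H) \<le> (1 - \<eta>) * (1 - ?V)"
    using damped_product[OF x, of UNIV d \<theta>] d_eq \<theta> damping by auto
  moreover have "0 \<le> \<eta> * ?V" "0 \<le> \<eta> * (1 - ?V)"
    using V \<eta> by auto
  ultimately have VH: "0 \<le> ?V - \<theta> * ?H" "?V - \<theta> * ?H \<le> 1 - \<theta>"
    by (auto simp: algebra_simps)
  have "\<delta> ^ d \<le> 1" using \<delta> by (simp add: power_le_one)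
  then have fine': "C * (real d / real (card S)) \<le> \<eta>"
    using fine mult_left_mono[of "\<delta> ^ d" 1 \<eta>] \<eta> by simp
  have dr: "real d / real (card S) \<le> C * (real d / real (card S))"
    using mult_right_mono[OF C_ge_1, of "real d / real (card S)"] by simp
  have "real d / real m \<le> real d / real (card S)"
    using card_S_le r by (intro divide_left_mono) auto
  then have I: "\<bar>?I - Q x\<bar> \<le> \<eta>"
    using interp_close[OF Q x] dr fine' unfolding d_eq by linarith
  have D: "\<bar>?D x\<bar> \<le> \<eta>"
  proof -
    fix k :: 'n
    have "\<bar>?D (upd x k (x $ k)) - ?D (upd x k 0)\<bar> \<le> (avg_ramp m S (x $ k) - avg_ramp m S 0) * (real d / real (card S))"
      unfolding d_eq using x01 by (intro spread_defect_incr(2)[OF B]) auto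
    moreover have "?D (upd x k 0) = 0" by (rule spread_defect_grounded[OF B, of _ k]) simp
    moreover have "avg_ramp m S (x $ k) * (real d / real (card S)) \<le> 1 * (real d / real (card S))"
      using avg_ramp_mono[OF x01(2)[of k]] by (intro mult_right_mono) auto
    ultimately show ?thesis using dr fine' by simp
  qed
  have Q01: "0 \<le> Q x" "Q x \<le> 1" using quasi_copula_nonneg[OF Q x] quasi_copula_le_one[OF Q x] .
  have QB: "0 \<le> (1 - \<theta>) * Q x" "(1 - \<theta>) * Q x \<le> 1 - \<theta>"
    using Q01 \<theta> by (auto simp: mult_left_le)
  have t1: "\<bar>\<theta> * (?I - Q x)\<bar> \<le> \<eta>" "\<bar>\<theta> * ?D x\<bar> \<le> \<eta>"
    using I D \<theta> mult_mono[of \<theta> 1 "\<bar>?I - Q x\<bar>" \<eta>] mult_mono[of \<theta> 1 "\<bar>?D x\<bar>" \<eta>] by (auto simp: abs_mult)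
  have "blend m S \<theta> Q R x - Q x = (?V - \<theta> * ?H) - (1 - \<theta>) * Q x + \<theta> * (?I - Q x) + \<theta> * ?D x"
    by (simp add: blend_def algebra_simps)
  then show ?thesis using VH QB t1 by linarith
qed

end

section \<open>Exchanging the two levels of the grid\<close>

text \<open>
  Exchanges the two digits of \<open>e\<close> in base \<open>m\<close>.
\<close>

definition swap :: "nat \<Rightarrow> nat \<Rightarrow> nat" where
  "swap m e = (e mod m) * m + e div m"

lemma swap_index: "i < m \<Longrightarrow> j < m \<Longrightarrow> swap m (i * m + j) = j * m + i"
  by (simp add: swap_def)

lemma pair_index_less: "i < m \<Longrightarrow> j < m \<Longrightarrow> i * m + j < m * (m :: nat)"
proof -
  assume "i < m" "j < m"
  then have "i * m + j < Suc i * m" by simp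
  also have "\<dots> \<le> m * m" using \<open>i < m\<close> by (intro mult_right_mono) auto
  finally show ?thesis .
qed

lemma swap_less: "e < m * m \<Longrightarrow> swap m e < m * m"
  unfolding swap_def by (intro pair_index_less) (auto simp: less_mult_imp_div_less intro!: mod_less_divisor gr0I)

lemma swap_swap: "e < m * m \<Longrightarrow> swap m (swap m e) = e"
proof -
  assume e: "e < m * m"
  then have "e div m < m" "e mod m < m"
    by (auto simp: less_mult_imp_div_less intro!: mod_less_divisor gr0I)
  then have "swap m (swap m e) = e div m * m + e mod m"
    using swap_index[of "e mod m" m "e div m"] by (simp add: swap_def)
  then show ?thesis by simp
qed

lemma bij_swap: "bij_betw (swap m) {..<m * m} {..<m * m}"
  by (rule bij_betw_byWitness[of _ "swap m"]) (auto simp: swap_less swap_swap)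

text \<open>
  Rescaling a coarse interval to \<open>[0, 1]\<close> and then locating the point among the \<open>m\<close> parts amounts to
  locating it on the fine grid.  Exchanging the digits of the fine index therefore exchanges the order of the two ramps.
\<close>

lemma ramp_ramp:
  assumes "j < m"
  shows "ramp m j (ramp m i t) = ramp (m * m) (i * m + j) t"
proof -
  define u where "u = real m * t - real i"
  have m: "real j + 1 \<le> real m" using assms by simp
  have *: "real (m * m) * t - real (i * m + j) = real m * u - real j"
    by (simp add: u_def algebra_simps)
  have "max 0 (min 1 (real m * max 0 (min 1 u) - real j)) = max 0 (min 1 (real m * u - real j))"
  proof -
    consider "u \<le> 0" | "0 \<le> u" "u \<le> 1" | "1 \<le> u" by linarith
    then show ?thesis
    proof cases
      case 1
      then have "real m * u \<le> 0" by (simp add: mult_nonneg_nonpos)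
      then show ?thesis using 1 by simp
    next
      case 3
      then have "real m * 1 \<le> real m * u" by (intro mult_left_mono) auto
      then have "1 \<le> real m * u - real j" using m by linarith
      then show ?thesis using 3 m by (simp add: min_absorb1)
    qed simp
  qed
  then show ?thesis unfolding ramp_def * by (simp add: u_def)
qed

text \<open>
  \<open>F\<close> and \<open>G\<close> are primitives, vanishing at 0, of step functions on the fine grid that differ by
  the exchange of the two levels.
\<close>

definition swap_pair :: "nat \<Rightarrow> (real \<Rightarrow> real) \<Rightarrow> (real \<Rightarrow> real) \<Rightarrow> bool" where
  "swap_pair m F G \<longleftrightarrow> (\<exists>a. \<forall>t\<in>{0..1}.
     F t = (\<Sum>e<m * m. a e * ramp (m * m) e t) \<and>
     G t = (\<Sum>e<m * m. a e * ramp (m * m) (swap m e) t))"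

lemma swap_pair_ramp:
  assumes "i < m" "j < m"
  shows "swap_pair m (\<lambda>t. ramp m j (ramp m i t)) (\<lambda>t. ramp m i (ramp m j t))"
  unfolding swap_pair_def
proof (intro exI ballI)
  fix t :: real
  have e: "i * m + j \<in> {..<m * m}" using pair_index_less[OF assms] by simp
  show "ramp m j (ramp m i t) = (\<Sum>e<m * m. (if e = i * m + j then 1 else 0) * ramp (m * m) e t) \<and>
     ramp m i (ramp m j t) = (\<Sum>e<m * m. (if e = i * m + j then 1 else 0) * ramp (m * m) (swap m e) t)"
    using e assms by (simp add: if_distrib[of "\<lambda>c. c * _"] ramp_ramp swap_index cong: if_cong)
qed

lemma swap_pair_sum:
  assumes "\<And>i. i \<in> I \<Longrightarrow> swap_pair m (F i) (G i)"
  shows "swap_pair m (\<lambda>t. \<Sum>i\<in>I. c i * F i t) (\<lambda>t. \<Sum>i\<in>I. c i * G i t)"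
proof -
  have "\<forall>i\<in>I. \<exists>a. \<forall>t\<in>{0..1}. F i t = (\<Sum>e<m * m. a e * ramp (m * m) e t) \<and>
      G i t = (\<Sum>e<m * m. a e * ramp (m * m) (swap m e) t)"
    using assms unfolding swap_pair_def by blast
  then obtain a where a: "\<forall>i\<in>I. \<forall>t\<in>{0..1}. F i t = (\<Sum>e<m * m. a i e * ramp (m * m) e t) \<and>
      G i t = (\<Sum>e<m * m. a i e * ramp (m * m) (swap m e) t)"
    by (rule bchoice[THEN exE])
  have "(\<Sum>i\<in>I. c i * (\<Sum>e<m * m. a i e * z e)) = (\<Sum>e<m * m. (\<Sum>i\<in>I. c i * a i e) * z e)" for z :: "nat \<Rightarrow> real"
    by (simp add: sum_distrib_left sum_distrib_right mult.assoc) (rule sum.swap)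
  then show ?thesis
    unfolding swap_pair_def using a by (intro exI[of _ "\<lambda>e. \<Sum>i\<in>I. c i * a i e"]) simp
qed

lemma swap_pair_diff:
  assumes "swap_pair m F G" "swap_pair m F' G'"
  shows "swap_pair m (\<lambda>t. F t - F' t) (\<lambda>t. G t - G' t)"
proof -
  have "swap_pair m (\<lambda>t. \<Sum>b\<in>UNIV. (if b then 1 else - 1) * (if b then F t else F' t))
    (\<lambda>t. \<Sum>b\<in>UNIV. (if b then 1 else - 1) * (if b then G t else G' t))"
    using swap_pair_sum[of UNIV m "\<lambda>b. if b then F else F'" "\<lambda>b. if b then G else G'" "\<lambda>b. if b then 1 else - 1"] assms
    by (simp add: if_distribR)
  then show ?thesis by (simp add: UNIV_bool)
qed

lemma swap_pair_cong:
  assumes "swap_pair m F G" "\<And>t. 0 \<le> t \<Longrightarrow> t \<le> 1 \<Longrightarrow> F' t = F t" "\<And>t. 0 \<le> t \<Longrightarrow> t \<le> 1 \<Longrightarrow> G' t = G t"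
  shows "swap_pair m F' G'"
  using assms unfolding swap_pair_def by simp

text \<open>
  The analogue of \<open>swap_pair\<close> on the cube, with the exchange made along all axes at once.  It is closed
  under linear combinations and contains products of one-dimensional pairs, so a shuffle of a
  sum of products can be computed factor by factor.
\<close>

definition cell_pair :: "nat \<Rightarrow> (real ^ 'n \<Rightarrow> real) \<Rightarrow> (real ^ 'n \<Rightarrow> real) \<Rightarrow> bool" where
  "cell_pair m A A' \<longleftrightarrow> (\<exists>\<nu>. \<forall>x\<in>cbox 0 1.
     A x = cell_cdf (m * m) \<nu> (\<lambda>e. e) x \<and> A' x = cell_cdf (m * m) \<nu> (swap m) x)"

lemma cell_pair_prod:
  fixes F G :: "'n::finite \<Rightarrow> real \<Rightarrow> real"
  assumes "\<And>k. swap_pair m (F k) (G k)"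
  shows "cell_pair m (\<lambda>x. \<Prod>k\<in>UNIV. F k (x $ k)) (\<lambda>x. \<Prod>k\<in>UNIV. G k (x $ k))"
proof -
  have "\<forall>k. \<exists>a. \<forall>t\<in>{0..1}. F k t = (\<Sum>e<m * m. a e * ramp (m * m) e t) \<and>
      G k t = (\<Sum>e<m * m. a e * ramp (m * m) (swap m e) t)"
    using assms unfolding swap_pair_def by blast
  then obtain a where a: "\<forall>k. \<forall>t\<in>{0..1}. F k t = (\<Sum>e<m * m. a k e * ramp (m * m) e t) \<and>
      G k t = (\<Sum>e<m * m. a k e * ramp (m * m) (swap m e) t)"
    by (rule choice[THEN exE])
  have "(\<Prod>k\<in>UNIV. \<Sum>e<m * m. a k e * ramp (m * m) (\<pi> e) (x $ k)) =
    cell_cdf (m * m) (\<lambda>c. \<Prod>k\<in>UNIV. a k (c k)) \<pi> x" for \<pi> and x :: "real ^ 'n"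
    unfolding cell_cdf_def
    using sum_PiE_prod[of "{..<m * m}" "\<lambda>k e. a k e * ramp (m * m) (\<pi> e) (x $ k)"]
    by (simp add: prod.distrib)
  then show ?thesis
    unfolding cell_pair_def using a
    by (intro exI[of _ "\<lambda>c. \<Prod>k\<in>UNIV. a k (c k)"]) (simp add: mem_box_cart)
qed

lemma cell_pair_sum:
  assumes "\<And>i. i \<in> I \<Longrightarrow> cell_pair m (A i) (A' i)"
  shows "cell_pair m (\<lambda>x. \<Sum>i\<in>I. c i * A i x) (\<lambda>x. \<Sum>i\<in>I. c i * A' i x)"
proof -
  have "\<forall>i\<in>I. \<exists>\<nu>. \<forall>x\<in>cbox 0 1. A i x = cell_cdf (m * m) \<nu> (\<lambda>e. e) x \<and>
      A' i x = cell_cdf (m * m) \<nu> (swap m) x"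
    using assms unfolding cell_pair_def by blast
  then obtain \<nu> where \<nu>: "\<forall>i\<in>I. \<forall>x\<in>cbox 0 1. A i x = cell_cdf (m * m) (\<nu> i) (\<lambda>e. e) x \<and>
      A' i x = cell_cdf (m * m) (\<nu> i) (swap m) x"
    by (rule bchoice[THEN exE])
  have "(\<Sum>i\<in>I. c i * cell_cdf (m * m) (\<nu> i) \<pi> x) = cell_cdf (m * m) (\<lambda>b. \<Sum>i\<in>I. c i * \<nu> i b) \<pi> x" for \<pi> x
    unfolding cell_cdf_def by (simp add: sum_distrib_left sum_distrib_right mult.assoc) (rule sum.swap)
  then show ?thesis
    unfolding cell_pair_def using \<nu> by (intro exI[of _ "\<lambda>b. \<Sum>i\<in>I. c i * \<nu> i b"]) simp
qed

lemma cell_pair_lincomb: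
  assumes "cell_pair m A A'" "cell_pair m B B'"
  shows "cell_pair m (\<lambda>x. a * A x + b * B x) (\<lambda>x. a * A' x + b * B' x)"
proof -
  have "cell_pair m (\<lambda>x. \<Sum>i\<in>UNIV. (if i then a else b) * (if i then A x else B x))
    (\<lambda>x. \<Sum>i\<in>UNIV. (if i then a else b) * (if i then A' x else B' x))"
    using cell_pair_sum[of UNIV m "\<lambda>i. if i then A else B" "\<lambda>i. if i then A' else B'" "\<lambda>i. if i then a else b"] assms
    by (simp add: if_distribR)
  then show ?thesis by (simp add: UNIV_bool add.commute)
qed

text \<open>
  The exchange of levels is an involution.
\<close>

lemma cell_pair_sym:
  assumes "cell_pair m A A'"
  shows "cell_pair m A' A"
proof -
  obtain \<nu> where \<nu>: "\<forall>x\<in>cbox 0 1. A x = cell_cdf (m * m) \<nu> (\<lambda>e. e) x \<and> A' x = cell_cdf (m * m) \<nu> (swap m) x"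
    using assms unfolding cell_pair_def by blast
  define \<nu>' where "\<nu>' c = \<nu> (swap m \<circ> c)" for c
  have "cell_cdf (m * m) \<nu> (swap m) x = cell_cdf (m * m) \<nu>' (\<lambda>e. e) x" for x
    unfolding cell_cdf_def \<nu>'_def
    by (rule sum.reindex_bij_witness[of _ "\<lambda>c. swap m \<circ> c" "\<lambda>c. swap m \<circ> c"])
      (auto simp: PiE_iff swap_less swap_swap fun_eq_iff comp_def)
  moreover have "cell_cdf (m * m) \<nu> (\<lambda>e. e) x = cell_cdf (m * m) \<nu>' (swap m) x" for x
    unfolding cell_cdf_def \<nu>'_def
    by (rule sum.reindex_bij_witness[of _ "\<lambda>c. swap m \<circ> c" "\<lambda>c. swap m \<circ> c"])
      (auto simp: PiE_iff swap_less swap_swap fun_eq_iff comp_def)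
  ultimately show ?thesis
    unfolding cell_pair_def using \<nu> by (intro exI[of _ \<nu>']) simp
qed

text \<open>
  The hat function of the grid point 0 does not vanish at 0, so it is no combination of ramps; it can be
  omitted since \<open>Q\<close> vanishes on the lower faces.
\<close>

lemma interp_eq_positive:
  fixes Q :: "real ^ 'n \<Rightarrow> real"
  assumes Q: "quasi_copula Q" and m: "0 < m"
  shows "interp m f Q x =
    (\<Sum>g\<in>UNIV \<rightarrow>\<^sub>E {1..m}. Q (grid_point m g) * (\<Prod>k\<in>UNIV. hat m f (g k) (x $ k)))"
  unfolding interp_def
proof (rule sum.mono_neutral_right)
  show "\<forall>g\<in>(UNIV \<rightarrow>\<^sub>E {..m}) - (UNIV \<rightarrow>\<^sub>E {1..m}). Q (grid_point m g) * (\<Prod>k\<in>UNIV. hat m f (g k) (x $ k)) = 0"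
  proof
    fix g :: "'n \<Rightarrow> nat" assume g: "g \<in> (UNIV \<rightarrow>\<^sub>E {..m}) - (UNIV \<rightarrow>\<^sub>E {1..m})"
    then have "\<exists>k. g k \<notin> {1..m}" "\<forall>k. g k \<le> m" by (auto simp: PiE_iff)
    then obtain k where "g k = 0" by (metis atLeastAtMost_iff less_one not_le)
    then have "Q (grid_point m g) = 0"
      using g m by (intro quasi_copula_grounded[OF Q, of _ k]) (auto simp: grid_point_def mem_box_cart PiE_iff)
    then show "Q (grid_point m g) * (\<Prod>k\<in>UNIV. hat m f (g k) (x $ k)) = 0" by simp
  qed
qed (auto simp: PiE_iff intro: finite_PiE)

context core
begin

interpretation profile m "avg_ramp m S"
  by (rule profile_avg_ramp)

lemma swap_pair_refined_ramp:
  assumes "i \<le> m"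
  shows "swap_pair m (\<lambda>t. avg_ramp m S (ramp m i t)) (\<lambda>t. \<Sum>j\<in>S. 1 / real (card S) * ramp m i (ramp m j t))"
proof (cases "i = m")
  case False
  have "swap_pair m (\<lambda>t. \<Sum>j\<in>S. 1 / real (card S) * ramp m j (ramp m i t)) (\<lambda>t. \<Sum>j\<in>S. 1 / real (card S) * ramp m i (ramp m j t))"
    using assms False S_sub by (intro swap_pair_sum swap_pair_ramp) auto
  then show ?thesis by (rule swap_pair_cong) (simp_all add: avg_ramp_def sum_divide_distrib)
next
  case True
  have "swap_pair m (\<lambda>_. 0) (\<lambda>_. 0)" using swap_pair_sum[of "{}" m] by simp
  then show ?thesis by (rule swap_pair_cong) (simp_all add: True ramp_top ramp_bounds)
qed

text \<open>
  The one-dimensional reason for the symmetry of \<open>blend\<close>: refining each coarse hat function by the core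
  distribution is exchanged with spreading small copies of this hat function over the core.
\<close>

lemma swap_pair_hat:
  assumes "g \<in> {1..m}"
  shows "swap_pair m (hat m (avg_ramp m S) g) (\<lambda>t. \<Sum>j\<in>S. 1 / real (card S) * hat m (\<lambda>t. t) g (ramp m j t))"
proof -
  have "swap_pair m (\<lambda>t. avg_ramp m S (ramp m (g - 1) t) - avg_ramp m S (ramp m g t))
    (\<lambda>t. (\<Sum>j\<in>S. 1 / real (card S) * ramp m (g - 1) (ramp m j t)) - (\<Sum>j\<in>S. 1 / real (card S) * ramp m g (ramp m j t)))"
    using assms by (intro swap_pair_diff swap_pair_refined_ramp) auto
  then show ?thesis
    using assms by (rule_tac swap_pair_cong) (auto simp: hat_def right_diff_distrib sum_subtractf)
qed

lemma swap_pair_id: "swap_pair m (\<lambda>t. t) (\<lambda>t. t)"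
proof -
  have eq: "t = (\<Sum>i<m. 1 / real m * (\<Sum>j<m. 1 / real m * ramp m j (ramp m i t)))"
    "t = (\<Sum>i<m. 1 / real m * (\<Sum>j<m. 1 / real m * ramp m i (ramp m j t)))" if "0 \<le> t" "t \<le> 1" for t
  proof -
    have r: "(\<Sum>j<m. ramp m j (ramp m i t)) = real m * ramp m i t" for i
      by (rule sum_ramp[OF ramp_bounds])
    show 1: "t = (\<Sum>i<m. 1 / real m * (\<Sum>j<m. 1 / real m * ramp m j (ramp m i t)))"
      using m_pos by (simp only: sum_distrib_left[symmetric] r) (simp add: sum_ramp[OF that])
    show "t = (\<Sum>i<m. 1 / real m * (\<Sum>j<m. 1 / real m * ramp m i (ramp m j t)))"
      unfolding sum_distrib_left by (subst sum.swap) (use 1 in \<open>simp add: sum_distrib_left\<close>)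
  qed
  have "swap_pair m (\<lambda>t. \<Sum>i<m. 1 / real m * (\<Sum>j<m. 1 / real m * ramp m j (ramp m i t)))
    (\<lambda>t. \<Sum>i<m. 1 / real m * (\<Sum>j<m. 1 / real m * ramp m i (ramp m j t)))"
    by (intro swap_pair_sum swap_pair_ramp) auto
  then show ?thesis by (rule swap_pair_cong) (rule eq, assumption+)+
qed

lemma swap_pair_grid_margin: "swap_pair m (grid_margin m (avg_ramp m S)) (avg_ramp m S)"
proof -
  have "swap_pair m (\<lambda>t. \<Sum>i<m. 1 / real m * avg_ramp m S (ramp m i t))
    (\<lambda>t. \<Sum>i<m. 1 / real m * (\<Sum>j\<in>S. 1 / real (card S) * ramp m i (ramp m j t)))"
    by (intro swap_pair_sum swap_pair_refined_ramp) auto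
  moreover have "avg_ramp m S t = (\<Sum>i<m. 1 / real m * (\<Sum>j\<in>S. 1 / real (card S) * ramp m i (ramp m j t)))" for t
  proof -
    have r: "(\<Sum>i<m. ramp m i (ramp m j t)) = real m * ramp m j t" for j
      by (rule sum_ramp[OF ramp_bounds])
    have "(\<Sum>i<m. 1 / real m * (\<Sum>j\<in>S. 1 / real (card S) * ramp m i (ramp m j t))) =
      (\<Sum>j\<in>S. 1 / real m * (1 / real (card S)) * (\<Sum>i<m. ramp m i (ramp m j t)))"
      unfolding sum_distrib_left by (subst sum.swap) (simp add: mult.assoc)
    also have "\<dots> = (\<Sum>j\<in>S. ramp m j t / real (card S))"
      unfolding r using m_pos by (intro sum.cong) auto
    finally show ?thesis by (simp add: avg_ramp_def sum_divide_distrib)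
  qed
  ultimately show ?thesis
    by (rule_tac swap_pair_cong) (auto simp: grid_margin_def sum_divide_distrib)
qed

lemma spread_interp:
  fixes x :: "real ^ 'n"
  assumes Q: "quasi_copula Q"
  shows "spread m S (interp m (\<lambda>t. t) Q) x =
    (\<Sum>g\<in>UNIV \<rightarrow>\<^sub>E {1..m}. Q (grid_point m g) *
      (\<Prod>k\<in>UNIV. \<Sum>j\<in>S. 1 / real (card S) * hat m (\<lambda>t. t) (g k) (ramp m j (x $ k))))"
proof -
  let ?r = "real (card S)"
  have "(\<Sum>i\<in>UNIV \<rightarrow>\<^sub>E S. interp m (\<lambda>t. t) Q (\<chi> k. ramp m (i k) (x $ k))) =
    (\<Sum>g\<in>UNIV \<rightarrow>\<^sub>E {1..m}. Q (grid_point m g) *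
      (\<Sum>i\<in>UNIV \<rightarrow>\<^sub>E S. \<Prod>k\<in>UNIV. hat m (\<lambda>t. t) (g k) (ramp m (i k) (x $ k))))"
    unfolding interp_eq_positive[OF Q m_pos] sum_distrib_left by (subst sum.swap) simp
  also have "\<dots> = (\<Sum>g\<in>UNIV \<rightarrow>\<^sub>E {1..m}. Q (grid_point m g) *
      (\<Prod>k\<in>UNIV. \<Sum>j\<in>S. hat m (\<lambda>t. t) (g k) (ramp m j (x $ k))))"
    using sum_PiE_prod[OF finite_S, of "\<lambda>k j. hat m (\<lambda>t. t) (_ k) (ramp m j (x $ k))"] by simp
  finally have "spread m S (interp m (\<lambda>t. t) Q) x = (\<Sum>g\<in>UNIV \<rightarrow>\<^sub>E {1..m}. Q (grid_point m g) *
      (\<Prod>k\<in>UNIV. \<Sum>j\<in>S. hat m (\<lambda>t. t) (g k) (ramp m j (x $ k)))) / ?r ^ CARD('n)"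
    by (simp only: spread_def)
  moreover have "(\<Prod>k\<in>UNIV. \<Sum>j\<in>S. 1 / ?r * z k j) = (\<Prod>k\<in>UNIV. \<Sum>j\<in>S. z k j) / ?r ^ CARD('n)"
    for z :: "'n \<Rightarrow> nat \<Rightarrow> real"
    by (simp add: sum_divide_distrib[symmetric] prod_dividef)
  ultimately show ?thesis
    by (simp only: sum_divide_distrib times_divide_eq_right)
qed

lemma cell_pair_interp_spread:
  fixes Q :: "real ^ 'n \<Rightarrow> real"
  assumes Q: "quasi_copula Q"
  shows "cell_pair m (interp m (avg_ramp m S) Q) (spread m S (interp m (\<lambda>t. t) Q))"
proof -
  have "cell_pair m
    (\<lambda>x. \<Sum>g\<in>UNIV \<rightarrow>\<^sub>E {1..m}. Q (grid_point m g) * (\<Prod>k\<in>UNIV. hat m (avg_ramp m S) (g k) (x $ k)))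
    (\<lambda>x. \<Sum>g\<in>UNIV \<rightarrow>\<^sub>E {1..m}. Q (grid_point m g) *
      (\<Prod>k\<in>UNIV. \<Sum>j\<in>S. 1 / real (card S) * hat m (\<lambda>t. t) (g k) (ramp m j (x $ k))))"
    by (intro cell_pair_sum cell_pair_prod swap_pair_hat) (auto simp: PiE_iff)
  then show ?thesis
    by (simp only: interp_eq_positive[OF Q m_pos, symmetric] spread_interp[OF Q, symmetric])
qed

lemma cell_pair_blend:
  fixes Q R :: "real ^ 'n \<Rightarrow> real"
  assumes Q: "quasi_copula Q" and R: "quasi_copula R"
  shows "cell_pair m (blend m S \<theta> Q R) (blend m S \<theta> R Q)"
proof -
  let ?f = "avg_ramp m S"
  let ?P = "\<lambda>(F :: real \<Rightarrow> real) (x :: real ^ 'n). \<Prod>k\<in>UNIV. F (x $ k)"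
  let ?J = "\<lambda>Q. spread m S (interp m (\<lambda>t. t) Q)"
  have id: "cell_pair m (?P (\<lambda>t. t)) (?P (\<lambda>t. t))" by (rule cell_pair_prod[OF swap_pair_id])
  have st: "cell_pair m (?P (grid_margin m ?f)) (?P ?f)" by (rule cell_pair_prod[OF swap_pair_grid_margin])
  have "cell_pair m
    (\<lambda>x. 1 * (1 * ?P (\<lambda>t. t) x + \<theta> * (1 * interp m ?f Q x + (- 1) * ?P (grid_margin m ?f) x)) +
      \<theta> * (1 * ?J R x + (- 1) * ?P ?f x))
    (\<lambda>x. 1 * (1 * ?P (\<lambda>t. t) x + \<theta> * (1 * ?J Q x + (- 1) * ?P ?f x)) +
      \<theta> * (1 * interp m ?f R x + (- 1) * ?P (grid_margin m ?f) x))"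
    by (intro cell_pair_lincomb id st cell_pair_sym[OF st] cell_pair_interp_spread[OF Q]
      cell_pair_sym[OF cell_pair_interp_spread[OF R]])
  moreover have "blend m S \<theta> Q R = (\<lambda>x. 1 * (1 * ?P (\<lambda>t. t) x + \<theta> * (1 * interp m ?f Q x + (- 1) * ?P (grid_margin m ?f) x)) +
      \<theta> * (1 * ?J R x + (- 1) * ?P ?f x))"
    by (simp add: fun_eq_iff blend_def spread_defect_def)
  moreover have "blend m S \<theta> R Q = (\<lambda>x. 1 * (1 * ?P (\<lambda>t. t) x + \<theta> * (1 * ?J Q x + (- 1) * ?P ?f x)) +
      \<theta> * (1 * interp m ?f R x + (- 1) * ?P (grid_margin m ?f) x))"
    by (simp add: fun_eq_iff blend_def spread_defect_def)
  ultimately show ?thesis by simp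
qed

lemma blend_is_shuffle:
  fixes Q R :: "real ^ 'n \<Rightarrow> real"
  assumes Q: "quasi_copula Q" and R: "quasi_copula R"
  shows "is_shuffle_of (blend m S \<theta> Q R) (blend m S \<theta> R Q)"
proof -
  obtain \<nu> where "\<forall>x\<in>cbox 0 1. blend m S \<theta> R Q x = cell_cdf (m * m) \<nu> (\<lambda>e. e) x \<and>
      blend m S \<theta> Q R x = cell_cdf (m * m) \<nu> (swap m) x"
    using cell_pair_blend[OF R Q, of \<theta>] unfolding cell_pair_def by blast
  then show ?thesis
    using m_pos by (intro is_shuffle_of_cell_cdf[of "m * m" "swap m" _ \<nu>] bij_swap) auto
qed

end

section \<open>Approximation by a quasi-copula and its shuffle\<close>

lemma sup_norm_less:
  fixes f :: "real ^ 'n \<Rightarrow> real"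
  assumes "\<And>u. u \<in> cbox 0 1 \<Longrightarrow> \<bar>f u\<bar> \<le> b" "b < \<epsilon>"
  shows "sup_norm f < \<epsilon>"
proof -
  have "sup_norm f \<le> b"
    unfolding sup_norm_def using assms(1) one_cube by (intro cSUP_least) auto
  then show ?thesis using assms(2) by simp
qed

text \<open>
  The parameters are chosen in this order: with \<open>m = (k + 2) * s\<close> and the core \<open>{s..<m - s}\<close>, the slope bound
  \<open>C = 1 + 2 / k\<close> and the distance \<open>\<delta> = 1 / (k + 2)\<close> depend on \<open>k\<close> alone.  A large \<open>k\<close> makes \<open>C ^ d\<close> so close to 1
  that \<open>1 - e\<close> compensates it with reserve \<open>e / 2\<close>; then \<open>s\<close> is made large to refine the grid.
\<close>

lemma trimmed_core_exists:
  assumes d: "0 < d" and e: "0 < e" "e < 1"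
  shows "\<exists>m S \<delta> C. trimmed_core m S \<delta> (e / 2) (1 - e) C d"
proof -
  have "(\<lambda>k. (1 - e) * (1 + 2 / real k) ^ d) \<longlonglongrightarrow> (1 - e) * (1 + 0) ^ d"
    by (intro tendsto_intros lim_const_over_n)
  moreover have "(1 - e) * (1 + 0) ^ d < 1 - e / 2" using e by simp
  ultimately have "eventually (\<lambda>k. (1 - e) * (1 + 2 / real k) ^ d < 1 - e / 2) sequentially"
    by (rule order_tendstoD(2))
  then obtain k where k: "0 < k" "(1 - e) * (1 + 2 / real k) ^ d < 1 - e / 2"
    by (metis (mono_tags, lifting) eventually_at_top_linorder le_add1 le_add2 add_gr_0 zero_less_one)
  define C \<delta> where "C = 1 + 2 / real k" and "\<delta> = 1 / (real k + 2)"
  have \<delta>: "0 < \<delta>" "\<delta> \<le> 1" by (auto simp: \<delta>_def)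
  have pos: "0 < e / 2 * \<delta> ^ d" using e \<delta> by simp
  obtain s :: nat where s: "C * real d / (e / 2 * \<delta> ^ d) < real s"
    using reals_Archimedean2 by blast
  have "0 \<le> C * real d / (e / 2 * \<delta> ^ d)"
    using pos by (intro divide_nonneg_pos) (auto simp: C_def)
  then have s0: "0 < real s" using s by linarith
  define m where "m = (k + 2) * s"
  define S where "S = {s..<m - s}"
  have ms: "m - s = s + k * s" "real (m - s) = real m - real s" "s \<le> m"
    by (auto simp: m_def algebra_simps)
  have card: "card S = k * s" by (simp add: S_def ms)
  have \<delta>m: "\<delta> * real m = real s" by (simp add: \<delta>_def m_def field_simps)
  have "trimmed_core m S \<delta> (e / 2) (1 - e) C d"
  proof
    show "S \<subseteq> {..<m}" by (auto simp: S_def)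
    show "S \<noteq> {}" using s0 k(1) by (simp add: S_def ms)
    show "\<delta> * real m \<le> real i \<and> real i + 1 \<le> (1 - \<delta>) * real m" if "i \<in> S" for i
    proof -
      have "s \<le> i" "i + 1 \<le> m - s" using that by (auto simp: S_def)
      then have "real s \<le> real i" "real (i + 1) \<le> real (m - s)" by (simp_all only: of_nat_le_iff)
      then show ?thesis using \<delta>m ms(2) by (simp add: left_diff_distrib)
    qed
    show "C = real m / real (card S)" using k(1) s0 by (simp add: C_def m_def card field_simps)
    show "(1 - e) * C ^ d \<le> 1 - e / 2" using k(2) by (simp add: C_def)
    have "C * real d < e / 2 * \<delta> ^ d * real s"
      using s pos by (simp add: pos_divide_less_eq mult.commute)
    then have "C * real d / real s \<le> e / 2 * \<delta> ^ d"
      using s0 by (simp add: pos_divide_le_eq)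
    moreover have "C * real d / real (card S) \<le> C * real d / real s"
      using k(1) s0 by (intro divide_left_mono) (auto simp: card C_def)
    ultimately have "C * real d / real (card S) \<le> e / 2 * \<delta> ^ d" by (rule order.trans[rotated])
    then show "C * (real d / real (card S)) \<le> e / 2 * \<delta> ^ d" by (simp only: times_divide_eq_right)
  qed (use \<delta> e d in auto)
  then show ?thesis by blast
qed

theorem theorem13:
  fixes Q1 Q2 :: "real ^ 'n \<Rightarrow> real" and \<epsilon> :: real
  assumes "CARD('n) \<ge> 2"
    and "quasi_copula Q1" and "quasi_copula Q2"
    and "\<epsilon> > 0"
  shows "\<exists>A1 A2 :: real ^ 'n \<Rightarrow> real.
           quasi_copula A1 \<and> quasi_copula A2 \<and>
           sup_norm (\<lambda>u. Q1 u - A1 u) < \<epsilon> \<and> sup_norm (\<lambda>u. Q2 u - A2 u) < \<epsilon> \<and>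
           is_shuffle_of A1 A2"
proof -
  \<comment> \<open>The error of \<open>blend_close\<close> is \<open>e + 2 * (e / 2) = 2 * e\<close>, which is at most \<open>\<epsilon> / 2\<close>.\<close>
  define e where "e = min (\<epsilon> / 4) (1 / 2)"
  have e: "0 < e" "e < 1" "2 * e < \<epsilon>" using assms(4) by (auto simp: e_def)
  obtain m S \<delta> C where tc: "trimmed_core m S \<delta> (e / 2) (1 - e) C CARD('n)"
    using trimmed_core_exists[OF _ e(1,2), of "CARD('n)"] by auto
  interpret trimmed_core m S \<delta> "e / 2" "1 - e" C "CARD('n)" by (rule tc)
  let ?A = "blend m S (1 - e)"
  have close: "sup_norm (\<lambda>u. Q u - ?A Q R u) < \<epsilon>" if "quasi_copula Q" "quasi_copula R" for Q R :: "real ^ 'n \<Rightarrow> real"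
    using blend_close[OF that refl] e by (intro sup_norm_less[where b = "2 * e"]) auto
  show ?thesis
  proof (intro exI conjI)
    show "quasi_copula (?A Q1 Q2)" "quasi_copula (?A Q2 Q1)"
      using assms(2,3) by (simp_all add: quasi_copula_blend)
    show "sup_norm (\<lambda>u. Q1 u - ?A Q1 Q2 u) < \<epsilon>" "sup_norm (\<lambda>u. Q2 u - ?A Q2 Q1 u) < \<epsilon>"
      using assms(2,3) by (simp_all add: close)
    show "is_shuffle_of (?A Q1 Q2) (?A Q2 Q1)"
      by (rule blend_is_shuffle[OF assms(2,3)])
  qed
qed

end
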